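(* Let $G$ be a graph on $n$ vertices, $k$ a positive integer and $\mathcal{F}$ a layered family of $G$ with thickness at most $k$, with set of centers $\mathcal{C}_{\mathcal{F}}$. Then for every $X\subseteq\mathcal{C}_{\mathcal{F}}$ there exists an $(X,\frac{95}{100})$-balanced separator $S$ in $G$ such that $S$ is downward closed and $\mathrm{fcov}_{\mathcal{F}}(S)\le 5000k\cdot\log 2n\cdot\log(f+4)\cdot f$, where $f$ is the optimum value of the following linear program in nonnegative variables $x_F$ ($F\in\mathcal{F}$) and $d_{u,v}$ ($u,v\in X$): minimize $\sum_{F\in\mathcal{F}}x_F$ subject to $\sum_{v\in X}d_{u,v}\ge |X|/10$ for all $u\in X$; $d_{u,v}\le\sum_{F\in\mathcal{F},\,F\cap P\ne\emptyset}x_F$ for all $u,v\in X$ and every induced $u$--$v$ path $P$ in $G$; and $d_{u,v}\le 1$ for all $u,v\in X$.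
   Context: Logarithms are base 2. Layered family: given an ordered partition $\Pi=(L_1,\dots,L_m)$ of $V(G)$, the layer digraph has an arc $(u,v)$ iff $uv\in E(G)$, $u\in L_i$, $v\in L_j$, $j<i$. $v$ is a descendant of $u$ (and $u$ an ancestor of $v$) if there is a directed path from $u$ to $v$ (including $v=u$). For each vertex $u$ with no in-arcs, the set of $u$ and all its descendants is in $\mathcal{F}$, with center $u$; $\mathcal{C}_{\mathcal{F}}$ is the set of centers. Thickness: smallest $k$ with every member meeting at most $k$ parts. A set $S$ is downward closed if it contains every descendant of each of its vertices. An $(X,\phi)$-balanced separator is a set $S\subseteq V(G)$ such that every connected component of $G-S$ contains at most $\phi|X|$ vertices of $X$. $\mathrm{fcov}_{\mathcal{F}}(S)$ is the minimum of $\sum_F y_F$ over nonnegative $\{y_F\}$ with $\sum_{F\ni v}y_F\ge1$ for all $v\in S$. *)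

theory Defs
  imports "HOL-Analysis.Analysis" "HOL-Library.Disjoint_Sets" "Graph_Theory.Graph_Theory"
begin

text \<open>
  A finite simple undirected graph is a \<^locale>\<open>pair_graph\<close>: a finite, loopfree digraph with a
  symmetric arc set, so that \<open>uv\<close> is an edge iff \<open>(u, v) \<in> parcs G\<close>.
\<close>

definition ordered_partition :: "'a set \<Rightarrow> 'a set list \<Rightarrow> bool" where
  "ordered_partition V Ls \<longleftrightarrow> distinct Ls \<and> partition_on V (set Ls)"

definition layer_digraph :: "'a pair_pre_digraph \<Rightarrow> 'a set list \<Rightarrow> 'a pair_pre_digraph" where
  "layer_digraph G Ls =
     \<lparr>pverts = pverts G,
      parcs = {(u, v). (u, v) \<in> parcs G \<and>
                 (\<exists>i j. i < length Ls \<and> j < i \<and> u \<in> Ls ! i \<and> v \<in> Ls ! j)}\<rparr>"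

definition descendants :: "'a pair_pre_digraph \<Rightarrow> 'a set list \<Rightarrow> 'a \<Rightarrow> 'a set" where
  "descendants G Ls u = {v. u \<rightarrow>\<^sup>*\<^bsub>layer_digraph G Ls\<^esub> v}"

definition layer_centers :: "'a pair_pre_digraph \<Rightarrow> 'a set list \<Rightarrow> 'a set" where
  "layer_centers G Ls = {u \<in> pverts G. in_arcs (layer_digraph G Ls) u = {}}"

text \<open>
  A center has no proper ancestor, so distinct centers have distinct descendant sets and
  the set of sets below is indexed faithfully by its centers.
\<close>

definition layered_family :: "'a pair_pre_digraph \<Rightarrow> 'a set list \<Rightarrow> 'a set set" where
  "layered_family G Ls = descendants G Ls ` layer_centers G Ls"

definition thickness :: "'a set list \<Rightarrow> 'a set set \<Rightarrow> nat" where
  "thickness Ls \<F> = (LEAST k. \<forall>A\<in>\<F>. card {L \<in> set Ls. A \<inter> L \<noteq> {}} \<le> k)"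

definition downward_closed :: "'a pair_pre_digraph \<Rightarrow> 'a set list \<Rightarrow> 'a set \<Rightarrow> bool" where
  "downward_closed G Ls S \<longleftrightarrow> (\<forall>u\<in>S. descendants G Ls u \<subseteq> S)"

definition is_component :: "('a, 'b) pre_digraph \<Rightarrow> ('a, 'b) pre_digraph \<Rightarrow> bool" where
  "is_component H C \<longleftrightarrow> pre_digraph.max_subgraph H Digraph_Component.connected C"

definition balanced_separator :: "'a pair_pre_digraph \<Rightarrow> 'a set \<Rightarrow> real \<Rightarrow> 'a set \<Rightarrow> bool" where
  "balanced_separator G X \<phi> S \<longleftrightarrow> S \<subseteq> pverts G \<and>
     (\<forall>C. is_component (with_proj G \<restriction> (pverts G - S)) C \<longrightarrow>
          real (card (verts C \<inter> X)) \<le> \<phi> * real (card X))"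

definition fractional_cover :: "'a set set \<Rightarrow> 'a set \<Rightarrow> ('a set \<Rightarrow> real) \<Rightarrow> bool" where
  "fractional_cover \<F> S y \<longleftrightarrow> (\<forall>A\<in>\<F>. 0 \<le> y A) \<and> (\<forall>v\<in>S. (\<Sum>A\<in>{A \<in> \<F>. v \<in> A}. y A) \<ge> 1)"

definition fcov :: "'a set set \<Rightarrow> 'a set \<Rightarrow> real" where
  "fcov \<F> S = Inf {\<Sum>A\<in>\<F>. y A | y. fractional_cover \<F> S y}"

text \<open>
  Induced paths are given by their vertex sequence; for \<open>u = v\<close> the only one is \<open>[u]\<close>.
\<close>

definition induced_path :: "'a pair_pre_digraph \<Rightarrow> 'a \<Rightarrow> 'a \<Rightarrow> 'a list \<Rightarrow> bool" where
  "induced_path G u v P \<longleftrightarrow> vpath P G \<and> hd P = u \<and> last P = v \<and>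
     (\<forall>i j. i < j \<and> j < length P \<and> (P ! i, P ! j) \<in> parcs G \<longrightarrow> j = Suc i)"

definition separator_lp_feasible ::
  "'a pair_pre_digraph \<Rightarrow> 'a set set \<Rightarrow> 'a set \<Rightarrow> ('a set \<Rightarrow> real) \<Rightarrow> ('a \<Rightarrow> 'a \<Rightarrow> real) \<Rightarrow> bool" where
  "separator_lp_feasible G \<F> X x d \<longleftrightarrow>
     (\<forall>A\<in>\<F>. 0 \<le> x A) \<and>
     (\<forall>u\<in>X. \<forall>v\<in>X. 0 \<le> d u v) \<and>
     (\<forall>u\<in>X. (\<Sum>v\<in>X. d u v) \<ge> real (card X) / 10) \<and>
     (\<forall>u\<in>X. \<forall>v\<in>X. \<forall>P. induced_path G u v P \<longrightarrow>
        d u v \<le> (\<Sum>A\<in>{A \<in> \<F>. A \<inter> set P \<noteq> {}}. x A)) \<and>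
     (\<forall>u\<in>X. \<forall>v\<in>X. d u v \<le> 1)"

definition separator_lp_opt :: "'a pair_pre_digraph \<Rightarrow> 'a set set \<Rightarrow> 'a set \<Rightarrow> real" where
  "separator_lp_opt G \<F> X = Inf {\<Sum>A\<in>\<F>. x A | x d. separator_lp_feasible G \<F> X x d}"

text \<open>
  For layered families both infima are attained, i.e. they are minima.
\<close>

lemma Inf_eq_attained:
  fixes m :: real
  assumes "m \<in> R" "\<And>r. r \<in> R \<Longrightarrow> m \<le> r"
  shows "Inf R = m"
  using assms by (meson cInf_eq_minimum)

lemma compact_box_fun:
  fixes K :: "'b::topological_space set"
  assumes "compact K"
  shows "compact {f :: 'i \<Rightarrow> 'b. \<forall>i. f i \<in> K}"
proof -
  have "compactin (product_topology (\<lambda>_. euclidean) UNIV) (PiE (UNIV :: 'i set) (\<lambda>_. K))"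
    using assms by (subst compactin_PiE) (auto simp: compactin_euclidean_iff)
  moreover have "PiE (UNIV :: 'i set) (\<lambda>_. K) = {f. \<forall>i. f i \<in> K}"
    by (auto simp: PiE_def)
  ultimately show ?thesis
    by (simp add: euclidean_product_topology compactin_euclidean_iff)
qed

lemma fcov_attained:
  assumes fin: "finite \<F>" and cov: "S \<subseteq> \<Union>\<F>"
  shows "\<exists>y. fractional_cover \<F> S y \<and> (\<Sum>A\<in>\<F>. y A) = fcov \<F> S"
proof -
  define B where "B = real (card \<F>)"
  define K where "K = {y. \<forall>A. y A \<in> {0..max 1 B}} \<inter> {y. fractional_cover \<F> S y}"
  have "closed {y. fractional_cover \<F> S y}"
    unfolding fractional_cover_def Ball_def
    by (intro closed_Collect_conj closed_Collect_all closed_Collect_imp closed_Collect_le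
          open_Collect_const continuous_on_const continuous_on_sum
          continuous_on_product_coordinates)
  then have "compact K"
    unfolding K_def by (intro compact_Int_closed compact_box_fun) auto
  moreover have one: "(\<lambda>_. 1) \<in> K"
  proof -
    have "1 \<le> (\<Sum>A\<in>{A \<in> \<F>. v \<in> A}. 1::real)" if "v \<in> S" for v
    proof -
      from cov that have "{A \<in> \<F>. v \<in> A} \<noteq> {}" by auto
      with fin show ?thesis by (simp add: Suc_le_eq card_gt_0_iff)
    qed
    then show ?thesis by (simp add: K_def fractional_cover_def)
  qed
  moreover have "continuous_on K (\<lambda>y. \<Sum>A\<in>\<F>. y A)"
    by (intro continuous_on_sum continuous_on_subset[OF continuous_on_product_coordinates]) auto
  ultimately obtain y where y: "y \<in> K" "\<And>z. z \<in> K \<Longrightarrow> (\<Sum>A\<in>\<F>. y A) \<le> (\<Sum>A\<in>\<F>. z A)"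
    using continuous_attains_inf[of K "\<lambda>y. \<Sum>A\<in>\<F>. y A"] by blast
  have "(\<Sum>A\<in>\<F>. y A) \<le> (\<Sum>A\<in>\<F>. z A)" if z: "fractional_cover \<F> S z" for z
  proof (cases "(\<Sum>A\<in>\<F>. z A) \<le> B")
    case True
    define z' where "z' = (\<lambda>A. if A \<in> \<F> then z A else 0)"
    have "z A \<le> max 1 B" if "A \<in> \<F>" for A
      using member_le_sum[of A \<F> z] True that fin z by (auto simp: fractional_cover_def)
    then have "z' \<in> K"
      using z by (auto simp: K_def z'_def fractional_cover_def)
    from y(2)[OF this] show ?thesis by (simp add: z'_def)
  next
    case False
    then show ?thesis using y(2)[OF one] by (simp add: B_def)
  qed
  then have "fcov \<F> S = (\<Sum>A\<in>\<F>. y A)"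
    unfolding fcov_def using y(1) by (intro Inf_eq_attained) (auto simp: K_def)
  with y(1) show ?thesis by (auto simp: K_def)
qed

lemma separator_lp_opt_attained:
  assumes fin: "finite \<F>" and cov: "pverts G \<subseteq> \<Union>\<F>"
  shows "\<exists>x d. separator_lp_feasible G \<F> X x d \<and> (\<Sum>A\<in>\<F>. x A) = separator_lp_opt G \<F> X"
proof -
  define B where "B = real (card \<F>)"
  define K where "K = ({x. \<forall>A. x A \<in> {0..max 1 B}} \<times> {d. \<forall>u. d u \<in> {e. \<forall>v. e v \<in> {0..1::real}}})
    \<inter> {p. separator_lp_feasible G \<F> X (fst p) (snd p)}"
  have c1: "continuous_on T (\<lambda>p. fst p A)" for A
    and T :: "(('a set \<Rightarrow> real) \<times> ('a \<Rightarrow> 'a \<Rightarrow> real)) set"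
    by (rule continuous_on_product_then_coordinatewise, rule continuous_on_fst, rule continuous_on_id)
  have c2: "continuous_on T (\<lambda>p. snd p u v)" for u v
    and T :: "(('a set \<Rightarrow> real) \<times> ('a \<Rightarrow> 'a \<Rightarrow> real)) set"
    by (rule continuous_on_product_then_coordinatewise, rule continuous_on_product_then_coordinatewise,
        rule continuous_on_snd, rule continuous_on_id)
  have "closed {p. separator_lp_feasible G \<F> X (fst p) (snd p)}"
    unfolding separator_lp_feasible_def Ball_def
    by (intro closed_Collect_conj closed_Collect_all closed_Collect_imp closed_Collect_le
          open_Collect_const continuous_on_const continuous_on_sum c1 c2)
  then have "compact K"
    unfolding K_def by (intro compact_Int_closed compact_Times compact_box_fun) auto
  moreover have one: "(\<lambda>_. 1, \<lambda>_ _. 1) \<in> K"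
  proof -
    have "1 \<le> (\<Sum>A\<in>{A \<in> \<F>. A \<inter> set P \<noteq> {}}. 1::real)" if "induced_path G u v P" for u v P
    proof -
      have "P \<noteq> []" "set P \<subseteq> pverts G"
        using that by (auto simp: induced_path_def vpath_def vwalk_def)
      then have "hd P \<in> set P" "hd P \<in> pverts G" by auto
      with cov have "{A \<in> \<F>. A \<inter> set P \<noteq> {}} \<noteq> {}" by blast
      with fin show ?thesis by (simp add: Suc_le_eq card_gt_0_iff)
    qed
    then show ?thesis by (auto simp: K_def separator_lp_feasible_def)
  qed
  moreover have "continuous_on K (\<lambda>p. \<Sum>A\<in>\<F>. fst p A)"
    by (intro continuous_on_sum c1)
  ultimately obtain p where p: "p \<in> K" "\<And>q. q \<in> K \<Longrightarrow> (\<Sum>A\<in>\<F>. fst p A) \<le> (\<Sum>A\<in>\<F>. fst q A)"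
    using continuous_attains_inf[of K "\<lambda>p. \<Sum>A\<in>\<F>. fst p A"] by blast
  have "(\<Sum>A\<in>\<F>. fst p A) \<le> (\<Sum>A\<in>\<F>. x A)" if f: "separator_lp_feasible G \<F> X x d" for x d
  proof (cases "(\<Sum>A\<in>\<F>. x A) \<le> B")
    case True
    define x' where "x' = (\<lambda>A. if A \<in> \<F> then x A else 0)"
    define d' where "d' = (\<lambda>u v. if u \<in> X \<and> v \<in> X then d u v else 0)"
    have xB: "x A \<le> max 1 B" if "A \<in> \<F>" for A
      using member_le_sum[of A \<F> x] True that fin f by (auto simp: separator_lp_feasible_def)
    have "(\<Sum>v\<in>X. d' u v) = (\<Sum>v\<in>X. d u v)" if "u \<in> X" for u
      using that by (simp add: d'_def)
    moreover have "(\<Sum>A\<in>{A \<in> \<F>. Q A}. x' A) = (\<Sum>A\<in>{A \<in> \<F>. Q A}. x A)" for Q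
      by (rule sum.cong) (auto simp: x'_def)
    ultimately have "separator_lp_feasible G \<F> X x' d'"
      using f unfolding separator_lp_feasible_def by (simp add: x'_def d'_def)
    moreover have "x' A \<in> {0..max 1 B}" "d' u v \<in> {0..1}" for A u v
      using f xB[of A] by (auto simp: x'_def d'_def separator_lp_feasible_def)
    ultimately have "(x', d') \<in> K"
      by (auto simp: K_def)
    from p(2)[OF this] show ?thesis by (simp add: x'_def)
  next
    case False
    then show ?thesis using p(2)[OF one] by (simp add: B_def)
  qed
  then have "separator_lp_opt G \<F> X = (\<Sum>A\<in>\<F>. fst p A)"
    unfolding separator_lp_opt_def using p(1) by (intro Inf_eq_attained) (auto simp: K_def)
  with p(1) show ?thesis by (auto simp: K_def)
qed

lemma layered_family_covers:
  assumes "ordered_partition (pverts G) Ls"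
  shows "pverts G \<subseteq> \<Union>(layered_family G Ls)"
proof
  fix v assume v: "v \<in> pverts G"
  let ?D = "with_proj (layer_digraph G Ls)"
  define Q where "Q = (\<lambda>i. \<exists>u\<in>pverts G. i < length Ls \<and> u \<in> Ls ! i \<and> u \<rightarrow>\<^sup>*\<^bsub>?D\<^esub> v)"
  have VD: "verts ?D = pverts G" by (simp add: layer_digraph_def)
  have layer: "\<exists>i<length Ls. u \<in> Ls ! i" if "u \<in> pverts G" for u
    using assms that unfolding ordered_partition_def partition_on_def
    by (metis UnionE in_set_conv_nth)
  have refl: "v \<rightarrow>\<^sup>*\<^bsub>?D\<^esub> v" using v VD by (simp add: reachable_def rtrancl_on_refl)
  have ex: "\<exists>i. Q i" using layer[OF v] v refl by (auto simp: Q_def)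
  have bd: "\<And>i. Q i \<Longrightarrow> i \<le> length Ls" by (auto simp: Q_def)
  define i where "i = (GREATEST i. Q i)"
  have "Q i" using ex bd unfolding i_def by (metis GreatestI_nat)
  then obtain u where u: "u \<in> pverts G" "i < length Ls" "u \<in> Ls ! i" "u \<rightarrow>\<^sup>*\<^bsub>?D\<^esub> v"
    by (auto simp: Q_def)
  have "in_arcs ?D u = {}"
  proof (rule ccontr)
    assume "in_arcs ?D u \<noteq> {}"
    then obtain w where w: "(w, u) \<in> parcs (layer_digraph G Ls)"
      by (auto simp: in_arcs_def)
    then obtain a b where ab: "a < length Ls" "b < a" "w \<in> Ls ! a" "u \<in> Ls ! b"
      by (auto simp: layer_digraph_def)
    have "b = i"
    proof (rule ccontr)
      assume "b \<noteq> i"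
      then have "Ls ! b \<noteq> Ls ! i" "Ls ! b \<in> set Ls" "Ls ! i \<in> set Ls"
        using assms ab u by (auto simp: ordered_partition_def nth_eq_iff_index_eq)
      then have "Ls ! b \<inter> Ls ! i = {}"
        using assms by (auto simp: ordered_partition_def partition_on_def disjoint_def)
      with ab u show False by auto
    qed
    have "w \<in> pverts G"
      using assms ab by (auto simp: ordered_partition_def partition_on_def)
    moreover from this have "w \<rightarrow>\<^sup>*\<^bsub>?D\<^esub> v"
    proof -
      have "(w, u) \<in> arcs_ends ?D"
        using w by (force simp: arcs_ends_def arc_to_ends_def)
      with \<open>w \<in> pverts G\<close> u(4) VD show ?thesis
        unfolding reachable_def by (metis converse_rtrancl_on_into_rtrancl_on)
    qed
    ultimately have "Q a" using ab by (auto simp: Q_def)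
    then have "a \<le> i" unfolding i_def using bd by (rule Greatest_le_nat)
    with ab \<open>b = i\<close> show False by simp
  qed
  with u show "v \<in> \<Union>(layered_family G Ls)"
    by (auto simp: layered_family_def layer_centers_def descendants_def)
qed

lemma finite_layered_family:
  assumes "pair_graph G"
  shows "finite (layered_family G Ls)"
proof -
  interpret pair_graph G by fact
  show ?thesis by (simp add: layered_family_def layer_centers_def)
qed

end

theory Submission
  imports Defs
begin

text \<open>
  Region growing. Give every cone (member of the family) the extra mass \<open>f / n\<close>, so that the
  weight of a vertex, the mass of the cones containing it, is at least \<open>f / n\<close>, and delete all
  vertices of weight at least \<open>\<theta>\<close>, which costs \<open>2 f / \<theta>\<close>. As long as a component \<open>H\<close> with more
  than \<open>95%\<close> of \<open>X\<close> remains, measure the distance of a vertex from some \<open>u \<in> X \<inter> H\<close> by the least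
  mass of the cones met by a connected subset of \<open>H\<close> joining the two. Along an arc \<open>(v, w)\<close> of the
  layer digraph both \<open>dist v \<le> dist w\<close> and \<open>dist w - weight w \<le> dist v - weight v\<close> hold, because
  every cone containing \<open>v\<close> contains \<open>w\<close>. Hence the sphere \<open>{v. dist v - weight v \<le> r < dist v}\<close>
  is downward closed up to deleted vertices, and the apex of a cone meeting the sphere in \<open>v\<close> has
  a distance that differs from \<open>r\<close> by at most \<open>weight v\<close>. So the sphere is covered by giving a
  cone \<open>A\<close> of mass \<open>z A\<close> about \<open>z A / max (f / n) \<bar>r - dist (apex A)\<bar>\<close>, whose average over \<open>r\<close> in
  a ring of width \<open>W\<close> is \<open>O(log n / W)\<close> times the mass of the cones with apex in the ring. Among
  \<open>O(log (f + 4))\<close> concentric rings, one contains no more mass than the ball inside it, and that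
  ball pays for the cut. The ball has at most \<open>95%\<close> of \<open>X\<close> by the constraints on \<open>d\<close>, so it is
  never charged again.
\<close>

section \<open>Connected sets\<close>

definition connected_in :: "('a \<times> 'a) set \<Rightarrow> 'a set \<Rightarrow> bool" where
  "connected_in E B \<longleftrightarrow> B \<times> B \<subseteq> rtrancl_on B E"

definition component_of :: "('a \<times> 'a) set \<Rightarrow> 'a set \<Rightarrow> 'a set \<Rightarrow> bool" where
  "component_of E U H \<longleftrightarrow> connected_in E H \<and> H \<subseteq> U \<and> E `` H \<inter> U \<subseteq> H"

definition heavy :: "('a \<times> 'a) set \<Rightarrow> 'a set \<Rightarrow> real \<Rightarrow> 'a set \<Rightarrow> bool" where
  "heavy E X \<phi> B \<longleftrightarrow> connected_in E B \<and> \<phi> * real (card X) < real (card (B \<inter> X))"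

lemma connected_in_singleton: "connected_in E {a}"
  by (simp add: connected_in_def)

lemma connected_in_if_reachable:
  assumes "sym E" and "\<And>v. v \<in> B \<Longrightarrow> (b, v) \<in> rtrancl_on B E"
  shows "connected_in E B"
proof -
  have "(v, b) \<in> rtrancl_on B E" if "v \<in> B" for v
    using assms(2)[OF that] rtrancl_on_sym[OF \<open>sym E\<close>] by (rule symD[rotated])
  then show ?thesis
    unfolding connected_in_def using assms(2) by (auto intro: rtrancl_on_trans)
qed

lemma connected_in_insert:
  assumes "sym E" "connected_in E B" "v \<in> B" "(v, w) \<in> E"
  shows "connected_in E (insert w B)"
proof (rule connected_in_if_reachable[OF \<open>sym E\<close>])
  have "(v, a) \<in> rtrancl_on (insert w B) E" if "a \<in> B" for a
    using assms that rtrancl_on_mono[of E E B "insert w B" v a] by (auto simp: connected_in_def)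
  then show "(v, a) \<in> rtrancl_on (insert w B) E" if "a \<in> insert w B" for a
    using that assms(3,4) by (auto intro: rtrancl_on_into_rtrancl_on)
qed

lemma connected_in_subset_closed:
  assumes "connected_in E B" "b \<in> B" "b \<in> Z" "E `` (B \<inter> Z) \<inter> B \<subseteq> Z"
  shows "B \<subseteq> Z"
proof
  fix a assume "a \<in> B"
  then have "(b, a) \<in> rtrancl_on B E"
    using assms by (auto simp: connected_in_def)
  then show "a \<in> Z"
    by (induction rule: rtrancl_on_induct) (use assms in auto)
qed

lemma connected_in_subset_component:
  assumes "connected_in E D" "D \<subseteq> U" "component_of E U H" "D \<inter> H \<noteq> {}"
  shows "D \<subseteq> H"
proof -
  obtain h where "h \<in> D" "h \<in> H"
    using assms(4) by blast
  then show ?thesis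
    using assms by (intro connected_in_subset_closed[of E D h H]) (auto simp: component_of_def)
qed

lemma connected_in_extends_to_component:
  assumes "sym E" "connected_in E B" "B \<subseteq> U" "b \<in> B"
  obtains H where "component_of E U H" "B \<subseteq> H"
proof
  define H where "H = rtrancl_on U E `` {b}"
  show "B \<subseteq> H"
    using assms rtrancl_on_mono[of E E B U b] by (auto simp: H_def connected_in_def)
  have "(b, v) \<in> rtrancl_on H E" if "v \<in> H" for v
  proof -
    from that have "(b, v) \<in> rtrancl_on U E"
      by (simp add: H_def)
    then show ?thesis
      by (induction rule: rtrancl_on_induct)
        (auto simp: H_def intro: rtrancl_on_into_rtrancl_on)
  qed
  then have "connected_in E H"
    by (rule connected_in_if_reachable[OF \<open>sym E\<close>])
  then show "component_of E U H"
    unfolding component_of_def H_def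
    by (auto dest: in_rtrancl_on_in_F intro: rtrancl_on_into_rtrancl_on)
qed

lemma heavy_meets:
  assumes "0 \<le> \<phi>" "heavy E X \<phi> B"
  shows "B \<inter> X \<noteq> {}"
proof -
  have "0 \<le> \<phi> * real (card X)"
    using assms(1) by simp
  then show ?thesis
    using assms(2) by (auto simp: heavy_def)
qed

lemma heavy_superset:
  assumes "finite X" "heavy E X \<phi> B" "connected_in E H" "B \<subseteq> H"
  shows "heavy E X \<phi> H"
proof -
  have "card (B \<inter> X) \<le> card (H \<inter> X)"
    using assms by (intro card_mono) auto
  then show ?thesis
    using assms by (auto simp: heavy_def)
qed

lemma not_heavy_if_Int_subset:
  assumes "finite X" "real (card (Z \<inter> X)) \<le> \<phi> * real (card X)" "B \<inter> X \<subseteq> Z"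
  shows "\<not> heavy E X \<phi> B"
proof -
  have "card (B \<inter> X) \<le> card (Z \<inter> X)"
    using assms by (intro card_mono) auto
  then show ?thesis
    using assms(2) by (auto simp: heavy_def)
qed

lemma heavy_Int_nonempty:
  assumes "finite X" "1 / 2 \<le> \<phi>" "heavy E X \<phi> B" "heavy E X \<phi> C"
  shows "B \<inter> C \<noteq> {}"
proof
  assume "B \<inter> C = {}"
  then have "card (B \<inter> X) + card (C \<inter> X) = card ((B \<inter> X) \<union> (C \<inter> X))"
    using assms(1) by (intro card_Un_disjoint[symmetric]) auto
  also have "\<dots> \<le> card X"
    using assms(1) by (intro card_mono) auto
  finally have "card (B \<inter> X) + card (C \<inter> X) \<le> card X" .
  moreover have "1 / 2 * real (card X) \<le> \<phi> * real (card X)"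
    using assms(2) by (intro mult_right_mono) auto
  ultimately show False
    using assms(3,4) by (simp add: heavy_def)
qed

section \<open>Masses and fractional covers\<close>

definition mass :: "'a set set \<Rightarrow> ('a set \<Rightarrow> real) \<Rightarrow> 'a set \<Rightarrow> real" where
  "mass \<F> z B = (\<Sum>A | A \<in> \<F> \<and> A \<inter> B \<noteq> {}. z A)"

lemma mass_singleton: "mass \<F> z {v} = (\<Sum>A | A \<in> \<F> \<and> v \<in> A. z A)"
  by (simp add: mass_def)

lemma mass_mono_weight: "(\<And>A. A \<in> \<F> \<Longrightarrow> z A \<le> z' A) \<Longrightarrow> mass \<F> z B \<le> mass \<F> z' B"
  unfolding mass_def by (intro sum_mono) auto

lemma mass_insert_absorb:
  assumes "w \<in> B" "\<And>A. A \<in> \<F> \<Longrightarrow> v \<in> A \<Longrightarrow> w \<in> A"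
  shows "mass \<F> z (insert v B) = mass \<F> z B"
  unfolding mass_def using assms by (intro sum.cong) auto

lemma mass_insert:
  assumes "finite \<F>"
  shows "mass \<F> z (insert w B) = mass \<F> z B + (\<Sum>A | A \<in> \<F> \<and> w \<in> A \<and> A \<inter> B = {}. z A)"
proof -
  have "{A \<in> \<F>. A \<inter> insert w B \<noteq> {}} = {A \<in> \<F>. A \<inter> B \<noteq> {}} \<union> {A \<in> \<F>. w \<in> A \<and> A \<inter> B = {}}"
    by auto
  then show ?thesis
    unfolding mass_def using assms by (simp only:) (subst sum.union_disjoint; auto)
qed

lemma mass_nonneg: "(\<And>A. A \<in> \<F> \<Longrightarrow> 0 \<le> z A) \<Longrightarrow> 0 \<le> mass \<F> z B"
  unfolding mass_def by (intro sum_nonneg) auto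

lemma one_le_mass_singleton:
  assumes "0 < mass \<F> z {v}" "\<And>A. A \<in> \<F> \<Longrightarrow> v \<in> A \<Longrightarrow> z A / mass \<F> z {v} \<le> y A"
  shows "1 \<le> mass \<F> y {v}"
proof -
  have "1 = (\<Sum>A | A \<in> \<F> \<and> v \<in> A. z A) / mass \<F> z {v}"
    using assms(1) by (simp add: mass_singleton)
  also have "\<dots> \<le> mass \<F> y {v}"
    unfolding sum_divide_distrib mass_singleton[of _ y] using assms(2) by (intro sum_mono) auto
  finally show ?thesis .
qed

context
  fixes \<F> :: "'a set set" and z :: "'a set \<Rightarrow> real"
  assumes finite_family: "finite \<F>" and weight_nonneg: "\<And>A. A \<in> \<F> \<Longrightarrow> 0 \<le> z A"
begin

lemma mass_mono: "B \<subseteq> C \<Longrightarrow> mass \<F> z B \<le> mass \<F> z C"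
  unfolding mass_def using finite_family weight_nonneg by (intro sum_mono2) auto

lemma mass_le_total: "mass \<F> z B \<le> sum z \<F>"
  unfolding mass_def using finite_family weight_nonneg by (intro sum_mono2) auto

lemma mass_singleton_mono:
  "(\<And>A. A \<in> \<F> \<Longrightarrow> v \<in> A \<Longrightarrow> w \<in> A) \<Longrightarrow> mass \<F> z {v} \<le> mass \<F> z {w}"
  unfolding mass_singleton using finite_family weight_nonneg by (intro sum_mono2) auto

lemma mass_insert_le: "mass \<F> z (insert w B) \<le> mass \<F> z B + mass \<F> z {w}"
  unfolding mass_insert[OF finite_family] mass_singleton
  using finite_family weight_nonneg by (intro add_left_mono sum_mono2) auto

lemma mass_insert_le_diff:
  assumes "v \<in> B" "\<And>A. A \<in> \<F> \<Longrightarrow> v \<in> A \<Longrightarrow> w \<in> A"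
  shows "mass \<F> z (insert w B) \<le> mass \<F> z B + (mass \<F> z {w} - mass \<F> z {v})"
proof -
  have "(\<Sum>A | A \<in> \<F> \<and> w \<in> A \<and> A \<inter> B = {}. z A) \<le> sum z ({A \<in> \<F>. w \<in> A} - {A \<in> \<F>. v \<in> A})"
    using finite_family weight_nonneg assms by (intro sum_mono2) auto
  also have "\<dots> = mass \<F> z {w} - mass \<F> z {v}"
    unfolding mass_singleton using finite_family assms by (intro sum_diff) auto
  finally show ?thesis
    by (simp add: mass_insert[OF finite_family])
qed

end

definition mass_ball ::
  "'a set \<Rightarrow> ('a \<times> 'a) set \<Rightarrow> 'a set set \<Rightarrow> ('a set \<Rightarrow> real) \<Rightarrow> real \<Rightarrow> 'a \<Rightarrow> 'a set" where
  "mass_ball V E \<F> z r u =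
    {v. \<exists>B\<subseteq>V. connected_in E B \<and> u \<in> B \<and> v \<in> B \<and> mass \<F> z B \<le> r}"

lemma fractional_cover_iff_mass:
  "fractional_cover \<F> S y \<longleftrightarrow> (\<forall>A\<in>\<F>. 0 \<le> y A) \<and> (\<forall>v\<in>S. 1 \<le> mass \<F> y {v})"
  by (simp add: fractional_cover_def mass_singleton)

lemma fcov_le:
  assumes "fractional_cover \<F> S y"
  shows "fcov \<F> S \<le> sum y \<F>"
  unfolding fcov_def
proof (rule cInf_lower)
  show "bdd_below {\<Sum>A\<in>\<F>. y A |y. fractional_cover \<F> S y}"
    by (intro bdd_belowI[of _ 0]) (auto simp: fractional_cover_def intro!: sum_nonneg)
qed (use assms in blast)

lemma fcov_empty: "fcov \<F> {} = 0"
  unfolding fcov_def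
proof (rule Inf_eq_attained)
  show "0 \<in> {\<Sum>A\<in>\<F>. y A |y. fractional_cover \<F> {} y}"
    by (auto simp: fractional_cover_def intro!: exI[of _ "\<lambda>_. 0"])
qed (auto simp: fractional_cover_def sum_nonneg)

lemma fcov_Un_le:
  assumes "finite \<F>" "S \<subseteq> \<Union>\<F>" "T \<subseteq> \<Union>\<F>"
  shows "fcov \<F> (S \<union> T) \<le> fcov \<F> S + fcov \<F> T"
proof -
  obtain y where y: "fractional_cover \<F> S y" "sum y \<F> = fcov \<F> S"
    using fcov_attained[OF assms(1,2)] by blast
  obtain y' where y': "fractional_cover \<F> T y'" "sum y' \<F> = fcov \<F> T"
    using fcov_attained[OF assms(1,3)] by blast
  have "mass \<F> y {v} \<le> mass \<F> (\<lambda>A. y A + y' A) {v}"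
    "mass \<F> y' {v} \<le> mass \<F> (\<lambda>A. y A + y' A) {v}" for v
    using y(1) y'(1) by (auto simp: fractional_cover_def intro: mass_mono_weight)
  then have "fractional_cover \<F> (S \<union> T) (\<lambda>A. y A + y' A)"
    using y(1) y'(1) unfolding fractional_cover_iff_mass by (fastforce intro: order_trans)
  then show ?thesis
    using fcov_le y(2) y'(2) by (fastforce simp: sum.distrib)
qed

lemma fcov_superlevel_le:
  assumes "0 < \<theta>" "\<And>A. A \<in> \<F> \<Longrightarrow> 0 \<le> z A" "\<And>v. v \<in> S \<Longrightarrow> \<theta> \<le> mass \<F> z {v}"
  shows "fcov \<F> S \<le> sum z \<F> / \<theta>"
proof -
  have "mass \<F> (\<lambda>A. z A / \<theta>) {v} = mass \<F> z {v} / \<theta>" for v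
    by (simp add: mass_def sum_divide_distrib)
  then have "fractional_cover \<F> S (\<lambda>A. z A / \<theta>)"
    using assms by (simp add: fractional_cover_iff_mass)
  then show ?thesis
    using fcov_le by (fastforce simp: sum_divide_distrib)
qed

section \<open>Families of cones\<close>

locale cone_family =
  fixes V :: "'a set" and E R :: "('a \<times> 'a) set" and centers :: "'a set"
  assumes finite_V: "finite V" and E_sub: "E \<subseteq> V \<times> V" and sym_E: "sym E" and R_sub: "R \<subseteq> E"
    and centers_sub: "centers \<subseteq> V" and centers_reach: "V \<subseteq> R\<^sup>* `` centers"
begin

definition cones :: "'a set set" where
  "cones = (\<lambda>c. R\<^sup>* `` {c}) ` centers"

definition apex :: "'a set \<Rightarrow> 'a" where
  "apex = inv_into centers (\<lambda>c. R\<^sup>* `` {c})"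

definition apex_mass :: "('a set \<Rightarrow> real) \<Rightarrow> 'a set \<Rightarrow> real" where
  "apex_mass z B = (\<Sum>A | A \<in> cones \<and> apex A \<in> B. z A)"

lemma finite_cones: "finite cones"
  unfolding cones_def using finite_V centers_sub by (blast intro: finite_subset)

lemma card_cones_le: "card cones \<le> card V"
proof -
  have "card cones \<le> card centers"
    unfolding cones_def using finite_V centers_sub by (blast intro: card_image_le finite_subset)
  also have "\<dots> \<le> card V"
    using finite_V centers_sub by (rule card_mono)
  finally show ?thesis .
qed

lemma V_sub_Union_cones: "V \<subseteq> \<Union>cones"
  using centers_reach by (auto simp: cones_def)

lemma apex_in_V:
  assumes "A \<in> cones"
  shows "apex A \<in> V"
proof -
  have "apex A \<in> centers"
    using assms unfolding cones_def apex_def by (rule inv_into_into)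
  then show ?thesis
    using centers_sub by blast
qed

lemma cone_apex: "A \<in> cones \<Longrightarrow> R\<^sup>* `` {apex A} = A"
  unfolding cones_def apex_def by (rule f_inv_into_f)

lemma cone_step: "A \<in> cones \<Longrightarrow> v \<in> A \<Longrightarrow> (v, w) \<in> R \<Longrightarrow> w \<in> A"
  using cone_apex by (metis Image_singleton_iff rtrancl.rtrancl_into_rtrancl)

lemma apex_mass_nonneg: "(\<And>A. A \<in> cones \<Longrightarrow> 0 \<le> z A) \<Longrightarrow> 0 \<le> apex_mass z B"
  unfolding apex_mass_def by (intro sum_nonneg) auto

lemma apex_mass_mono:
  "(\<And>A. A \<in> cones \<Longrightarrow> 0 \<le> z A) \<Longrightarrow> B \<subseteq> C \<Longrightarrow> apex_mass z B \<le> apex_mass z C"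
  unfolding apex_mass_def using finite_cones by (intro sum_mono2) auto

lemma apex_mass_le_total: "(\<And>A. A \<in> cones \<Longrightarrow> 0 \<le> z A) \<Longrightarrow> apex_mass z B \<le> sum z cones"
  unfolding apex_mass_def using finite_cones by (intro sum_mono2) auto

lemma apex_mass_disjoint_Un:
  assumes "B \<inter> C = {}"
  shows "apex_mass z (B \<union> C) = apex_mass z B + apex_mass z C"
proof -
  have "{A \<in> cones. apex A \<in> B \<union> C} = {A \<in> cones. apex A \<in> B} \<union> {A \<in> cones. apex A \<in> C}"
    by auto
  then show ?thesis
    unfolding apex_mass_def using finite_cones assms
    by (simp only:) (subst sum.union_disjoint; auto)
qed

end

section \<open>Distances inside a component\<close>

locale cone_region = cone_family +
  fixes z :: "'a set \<Rightarrow> real" and S H :: "'a set" and u :: 'a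
  assumes z_nonneg: "A \<in> cones \<Longrightarrow> 0 \<le> z A"
    and S_closed: "R `` S \<subseteq> S"
    and H_component: "component_of E (V - S) H"
    and u_in_H: "u \<in> H"
begin

abbreviation weight :: "'a \<Rightarrow> real" where
  "weight v \<equiv> mass cones z {v}"

definition joining :: "'a \<Rightarrow> 'a set set" where
  "joining v = {B. B \<subseteq> H \<and> connected_in E B \<and> u \<in> B \<and> v \<in> B}"

definition cone_dist :: "'a \<Rightarrow> real" where
  "cone_dist v = Min (mass cones z ` joining v)"

definition cone_ball :: "real \<Rightarrow> 'a set" where
  "cone_ball r = {v \<in> H. cone_dist v \<le> r}"

definition cone_sphere :: "real \<Rightarrow> 'a set" where
  "cone_sphere r = {v \<in> H. cone_dist v - weight v \<le> r \<and> r < cone_dist v}"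

lemma H_connected: "connected_in E H" and H_sub: "H \<subseteq> V - S"
  and H_step: "v \<in> H \<Longrightarrow> (v, w) \<in> E \<Longrightarrow> w \<in> V - S \<Longrightarrow> w \<in> H"
  using H_component by (auto simp: component_of_def)

lemma finite_joining: "finite (joining v)"
proof -
  have "finite H"
    using H_sub finite_V by (meson finite_Diff finite_subset)
  then show ?thesis
    by (rule finite_subset[rotated, OF iffD2[OF finite_Pow_iff]]) (auto simp: joining_def)
qed

lemma cone_dist_le: "B \<in> joining v \<Longrightarrow> cone_dist v \<le> mass cones z B"
  unfolding cone_dist_def using finite_joining by (intro Min_le) auto

lemma cone_dist_attained:
  assumes "v \<in> H"
  obtains B where "B \<in> joining v" "cone_dist v = mass cones z B"
proof -
  have "H \<in> joining v"
    using assms H_connected u_in_H by (simp add: joining_def)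
  then have "cone_dist v \<in> mass cones z ` joining v"
    unfolding cone_dist_def using finite_joining by (intro Min_in) auto
  with that show ?thesis
    by auto
qed

lemma joining_insert:
  "B \<in> joining v \<Longrightarrow> (v, w) \<in> E \<Longrightarrow> w \<in> H \<Longrightarrow> insert w B \<in> joining w"
  using connected_in_insert[OF sym_E] by (auto simp: joining_def)

lemma cone_dist_source_le: "cone_dist u \<le> weight u"
  using u_in_H by (intro cone_dist_le) (simp add: joining_def connected_in_singleton)

lemma cone_dist_edge_le:
  assumes "v \<in> H" "w \<in> H" "(v, w) \<in> E"
  shows "cone_dist w \<le> cone_dist v + weight w"
proof -
  obtain B where B: "B \<in> joining v" "cone_dist v = mass cones z B"
    using cone_dist_attained assms by blast
  have "cone_dist w \<le> mass cones z (insert w B)"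
    using joining_insert B assms by (blast intro: cone_dist_le)
  also have "\<dots> \<le> mass cones z B + weight w"
    using finite_cones z_nonneg by (rule mass_insert_le)
  finally show ?thesis
    using B by simp
qed

lemma arc_tail_in_H:
  assumes "w \<in> H" "(v, w) \<in> R"
  shows "v \<in> H"
proof -
  have "(w, v) \<in> E"
    using assms R_sub sym_E by (auto dest: symD)
  moreover have "v \<notin> S"
    using S_closed assms H_sub by blast
  ultimately show ?thesis
    using H_step assms E_sub by blast
qed

lemma cone_dist_arc_mono:
  assumes "w \<in> H" "(v, w) \<in> R"
  shows "cone_dist v \<le> cone_dist w"
proof -
  have wv: "(w, v) \<in> E"
    using assms R_sub sym_E by (auto dest: symD)
  obtain B where B: "B \<in> joining w" "cone_dist w = mass cones z B"
    using cone_dist_attained assms by blast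
  have "cone_dist v \<le> mass cones z (insert v B)"
    using joining_insert[OF B(1) wv arc_tail_in_H[OF assms]] by (rule cone_dist_le)
  also have "\<dots> = mass cones z B"
    using B(1) assms cone_step by (intro mass_insert_absorb[of w]) (auto simp: joining_def)
  finally show ?thesis
    using B by simp
qed

lemma cone_dist_minus_weight_arc_antimono:
  assumes "w \<in> H" "(v, w) \<in> R"
  shows "cone_dist w - weight w \<le> cone_dist v - weight v"
proof -
  obtain B where B: "B \<in> joining v" "cone_dist v = mass cones z B"
    using cone_dist_attained arc_tail_in_H[OF assms] by blast
  have "cone_dist w \<le> mass cones z (insert w B)"
    using joining_insert B assms R_sub by (blast intro: cone_dist_le)
  also have "\<dots> \<le> mass cones z B + (weight w - weight v)"
    using B(1) assms cone_step
    by (intro mass_insert_le_diff[OF finite_cones z_nonneg]) (auto simp: joining_def)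
  finally show ?thesis
    using B by simp
qed

lemma apex_in_H:
  assumes "A \<in> cones" "v \<in> A" "v \<in> H"
  shows "apex A \<in> H"
proof -
  have "(apex A, v) \<in> R\<^sup>*"
    using cone_apex assms by blast
  then show ?thesis
    by (induction rule: converse_rtrancl_induct) (use assms arc_tail_in_H in auto)
qed

lemma cone_dist_apex:
  assumes "A \<in> cones" "v \<in> A" "v \<in> H"
  shows "cone_dist (apex A) \<le> cone_dist v" "cone_dist v \<le> cone_dist (apex A) + weight v"
proof -
  have "(apex A, v) \<in> R\<^sup>*"
    using cone_apex assms by blast
  then have "apex A \<in> H \<and> cone_dist (apex A) \<le> cone_dist v
      \<and> cone_dist v - weight v \<le> cone_dist (apex A) - weight (apex A)"
  proof (induction rule: converse_rtrancl_induct)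
    case (step a b)
    then show ?case
      using arc_tail_in_H[of b a] cone_dist_arc_mono[of b a]
        cone_dist_minus_weight_arc_antimono[of b a] by linarith
  qed (use assms in auto)
  moreover have "0 \<le> weight (apex A)"
    using z_nonneg by (rule mass_nonneg)
  ultimately show "cone_dist (apex A) \<le> cone_dist v"
    "cone_dist v \<le> cone_dist (apex A) + weight v"
    by linarith+
qed

lemma dist_apex_cone_sphere_le:
  assumes "A \<in> cones" "v \<in> A" "v \<in> cone_sphere r"
  shows "\<bar>r - cone_dist (apex A)\<bar> \<le> weight v"
  using assms cone_dist_apex[of A v] by (auto simp: cone_sphere_def)

lemma cone_sphere_closed: "R `` cone_sphere r \<subseteq> S \<union> cone_sphere r"
proof
  fix w assume "w \<in> R `` cone_sphere r"
  then obtain v where v: "v \<in> cone_sphere r" "(v, w) \<in> R"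
    by blast
  show "w \<in> S \<union> cone_sphere r"
  proof (cases "w \<in> S")
    case False
    then have "w \<in> H"
      using v H_step[of v w] R_sub E_sub by (auto simp: cone_sphere_def)
    then show ?thesis
      using v cone_dist_arc_mono cone_dist_minus_weight_arc_antimono
      by (fastforce simp: cone_sphere_def)
  qed simp
qed

lemma cone_ball_exit: "E `` cone_ball r \<inter> (H - cone_sphere r) \<subseteq> cone_ball r"
  using cone_dist_edge_le by (fastforce simp: cone_ball_def cone_sphere_def)

lemma card_cone_ball_le:
  assumes "r \<le> s" "finite X"
  shows "card (cone_ball r \<inter> X) \<le> card (mass_ball V E cones z s u \<inter> X)"
proof -
  have "v \<in> mass_ball V E cones z s u" if v: "v \<in> cone_ball r" for v
  proof -
    obtain B where "B \<in> joining v" "cone_dist v = mass cones z B"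
      using cone_dist_attained v by (auto simp: cone_ball_def)
    then show ?thesis
      using v H_sub \<open>r \<le> s\<close>
      unfolding mass_ball_def by (intro CollectI exI[of _ B]) (auto simp: cone_ball_def joining_def)
  qed
  then show ?thesis
    using assms(2) by (intro card_mono) auto
qed

lemma cone_dist_le_apex_mass:
  assumes "v \<in> cone_ball r"
  shows "cone_dist v \<le> apex_mass z (cone_ball r)"
proof -
  have v: "v \<in> H" "cone_dist v \<le> r"
    using assms by (auto simp: cone_ball_def)
  obtain B where B: "B \<in> joining v" "cone_dist v = mass cones z B"
    using cone_dist_attained v by blast
  have "apex A \<in> cone_ball r" if A: "A \<in> cones" "A \<inter> B \<noteq> {}" for A
  proof -
    obtain b where b: "b \<in> A" "b \<in> B"
      using A by blast
    then have "b \<in> H" "cone_dist b \<le> cone_dist v"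
      using B cone_dist_le[of B b] by (auto simp: joining_def)
    then show ?thesis
      using apex_in_H[OF A(1) b(1)] cone_dist_apex[OF A(1) b(1)] v by (simp add: cone_ball_def)
  qed
  then have "mass cones z B \<le> apex_mass z (cone_ball r)"
    unfolding mass_def apex_mass_def using z_nonneg finite_cones by (intro sum_mono2) auto
  with B show ?thesis
    by simp
qed

lemma apex_mass_cone_ball_gt:
  assumes light: "\<And>v. v \<in> V - S \<Longrightarrow> weight v < \<theta>" and "\<theta> \<le> r"
    and far: "w \<in> H" "r < cone_dist w"
  shows "r - \<theta> < apex_mass z (cone_ball r)"
proof -
  have "u \<in> cone_ball r"
    using cone_dist_source_le light[of u] u_in_H H_sub \<open>\<theta> \<le> r\<close> by (auto simp: cone_ball_def)
  moreover have "\<not> H \<subseteq> cone_ball r"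
    using far by (auto simp: cone_ball_def)
  ultimately obtain a b where ab: "a \<in> cone_ball r" "b \<in> H" "(a, b) \<in> E" "b \<notin> cone_ball r"
    using connected_in_subset_closed[OF H_connected u_in_H, of "cone_ball r"] by blast
  then have "r < cone_dist b" "a \<in> H" "weight b < \<theta>"
    using light H_sub by (auto simp: cone_ball_def)
  then have "r - \<theta> < cone_dist a"
    using cone_dist_edge_le[of a b] ab by simp
  also have "\<dots> \<le> apex_mass z (cone_ball r)"
    using ab(1) by (rule cone_dist_le_apex_mass)
  finally show ?thesis .
qed

end

section \<open>Averaging over the radius\<close>

lemma exists_non_doubling:
  fixes U :: "nat \<Rightarrow> real"
  assumes "c < U 0" "U n \<le> 2 ^ n * c"
  shows "\<exists>j<n. U (Suc j) \<le> 2 * U j"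
proof (rule ccontr)
  assume "\<not> ?thesis"
  then have doubling: "2 * U j < U (Suc j)" if "j < n" for j
    using that by auto
  have "2 ^ j * c < U j" if "j \<le> n" for j
    using that
  proof (induction j)
    case (Suc j)
    then show ?case
      using doubling[of j] by simp
  qed (use assms in simp)
  from this[of n] show False
    using assms by simp
qed

lemma weighted_translates_mean_value:
  fixes x p :: "'i \<Rightarrow> real"
  assumes "\<alpha> < \<beta>" "\<And>t. (\<Psi> has_real_derivative \<psi> t) (at t)"
  obtains r where "\<alpha> < r" "r < \<beta>"
    "(\<beta> - \<alpha>) * (\<Sum>i\<in>I. x i * \<psi> (r - p i)) = (\<Sum>i\<in>I. x i * (\<Psi> (\<beta> - p i) - \<Psi> (\<alpha> - p i)))"
proof -
  have "((\<lambda>r. \<Sum>i\<in>I. x i * \<Psi> (r - p i)) has_real_derivative (\<Sum>i\<in>I. x i * \<psi> (r - p i))) (at r)" for r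
  proof (intro DERIV_sum DERIV_cmult)
    show "((\<lambda>r. \<Psi> (r - p i)) has_real_derivative \<psi> (r - p i)) (at r)" for i
      using assms(2)[of "r - p i"] DERIV_shift[of \<Psi> "\<psi> (r - p i)" r "- p i"] by simp
  qed
  from MVT2[OF \<open>\<alpha> < \<beta>\<close> this] that show thesis
    by (auto simp: sum_subtractf right_diff_distrib)
qed

lemma arsinh_scaled_has_real_derivative:
  fixes \<delta> :: real
  assumes "0 < \<delta>"
  shows "((\<lambda>t. arsinh (t / \<delta>)) has_real_derivative 1 / sqrt (t\<^sup>2 + \<delta>\<^sup>2)) (at t)"
proof -
  have "sqrt (t\<^sup>2 + \<delta>\<^sup>2) = sqrt (\<delta>\<^sup>2 * ((t / \<delta>)\<^sup>2 + 1))"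
    using assms by (simp add: field_simps)
  also have "\<dots> = \<delta> * sqrt ((t / \<delta>)\<^sup>2 + 1)"
    using assms by (simp add: real_sqrt_mult)
  finally have "1 / sqrt (t\<^sup>2 + \<delta>\<^sup>2) = 1 / sqrt ((t / \<delta>)\<^sup>2 + 1) * (1 / \<delta>)"
    by simp
  moreover have "((\<lambda>t. arsinh (t / \<delta>)) has_real_derivative
      1 / sqrt ((t / \<delta>)\<^sup>2 + 1) * (1 / \<delta>)) (at t)"
    using assms
    by (intro DERIV_chain2[OF arsinh_real_has_field_derivative]) (auto intro!: derivative_eq_intros)
  ultimately show ?thesis
    by simp
qed

text \<open>
  The averaged function is a smooth substitute for \<open>1 / max \<delta> \<bar>r - p i\<bar>\<close>.
\<close>

lemma exists_cheap_radius:
  fixes x p :: "'i \<Rightarrow> real"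
  assumes x: "\<And>i. i \<in> I \<Longrightarrow> 0 \<le> x i" and p: "\<And>i. i \<in> I \<Longrightarrow> p i \<in> {a..b}"
    and "0 < \<delta>" "a \<le> \<alpha>" "\<alpha> < \<beta>" "\<beta> \<le> b"
  obtains r where "\<alpha> < r" "r < \<beta>"
    "(\<Sum>i\<in>I. x i / sqrt ((r - p i)\<^sup>2 + \<delta>\<^sup>2)) \<le> 2 * arsinh ((b - a) / \<delta>) / (\<beta> - \<alpha>) * sum x I"
proof -
  let ?L = "arsinh ((b - a) / \<delta>)"
  obtain r where r: "\<alpha> < r" "r < \<beta>"
    "(\<beta> - \<alpha>) * (\<Sum>i\<in>I. x i * (1 / sqrt ((r - p i)\<^sup>2 + \<delta>\<^sup>2))) =
      (\<Sum>i\<in>I. x i * (arsinh ((\<beta> - p i) / \<delta>) - arsinh ((\<alpha> - p i) / \<delta>)))"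
    using weighted_translates_mean_value[OF \<open>\<alpha> < \<beta>\<close> arsinh_scaled_has_real_derivative[OF \<open>0 < \<delta>\<close>],
        where I = I and x = x and p = p] by blast
  have arsinh_mono: "arsinh s \<le> arsinh t" if "s \<le> t" for s t :: real
    using that arsinh_less_iff_real[of t s] by linarith
  have "arsinh ((\<beta> - p i) / \<delta>) - arsinh ((\<alpha> - p i) / \<delta>) \<le> 2 * ?L" if "i \<in> I" for i
  proof -
    have "\<beta> - p i \<le> b - a" "a - b \<le> \<alpha> - p i"
      using p[OF that] assms(4-6) by auto
    then have "arsinh ((\<beta> - p i) / \<delta>) \<le> ?L" "arsinh ((a - b) / \<delta>) \<le> arsinh ((\<alpha> - p i) / \<delta>)"
      using \<open>0 < \<delta>\<close> by (intro arsinh_mono divide_right_mono; simp)+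
    moreover have "arsinh ((a - b) / \<delta>) = - ?L"
      using arsinh_minus_real[of "(b - a) / \<delta>"] by (simp add: minus_divide_left)
    ultimately show ?thesis
      by linarith
  qed
  then have "(\<Sum>i\<in>I. x i * (arsinh ((\<beta> - p i) / \<delta>) - arsinh ((\<alpha> - p i) / \<delta>)))
      \<le> (\<Sum>i\<in>I. x i * (2 * ?L))"
    using x by (intro sum_mono mult_left_mono)
  with r(3) have "(\<beta> - \<alpha>) * (\<Sum>i\<in>I. x i / sqrt ((r - p i)\<^sup>2 + \<delta>\<^sup>2)) \<le> 2 * ?L * sum x I"
    by (simp add: sum_distrib_right[symmetric] mult.commute)
  with r(1,2) \<open>\<alpha> < \<beta>\<close> that show thesis
    by (simp add: field_simps)
qed

lemma inverse_le_two_divide_sqrt: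
  fixes t \<delta> m :: real
  assumes "0 < \<delta>" "\<delta> \<le> m" "\<bar>t\<bar> \<le> m"
  shows "1 / m \<le> 2 / sqrt (t\<^sup>2 + \<delta>\<^sup>2)"
proof -
  have "sqrt (t\<^sup>2 + \<delta>\<^sup>2) \<le> \<bar>t\<bar> + \<bar>\<delta>\<bar>"
    by (rule sqrt_sum_squares_le_sum_abs)
  then have "sqrt (t\<^sup>2 + \<delta>\<^sup>2) \<le> 2 * m"
    using assms by simp
  moreover have "0 < sqrt (t\<^sup>2 + \<delta>\<^sup>2)"
    using assms by (simp add: add_nonneg_pos)
  ultimately show ?thesis
    using assms by (simp add: field_simps)
qed

lemma arsinh_le_ln:
  fixes t :: real
  assumes "0 \<le> t"
  shows "arsinh t \<le> ln (2 * t + 1)"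
proof -
  have "sqrt (t\<^sup>2 + 1) \<le> t + 1"
    using sqrt_sum_squares_le_sum_abs[of t 1] assms by simp
  moreover have "0 < t + sqrt (t\<^sup>2 + 1)"
    using arsinh_real_aux[of t] by simp
  ultimately show ?thesis
    using assms by (simp add: arsinh_real_def)
qed

lemma arsinh_half_le_log:
  fixes n :: real
  assumes "1 \<le> n" "t \<le> n / 2"
  shows "arsinh t \<le> log 2 (2 * n)"
proof -
  have "arsinh t \<le> arsinh (n / 2)"
    using arsinh_less_iff_real[of "n / 2" t] assms(2) by linarith
  also have "\<dots> \<le> ln (n + 1)"
    using arsinh_le_ln[of "n / 2"] assms(1) by simp
  also have "\<dots> \<le> ln (2 * n)"
    using assms(1) by simp
  also have "\<dots> \<le> log 2 (2 * n)"
    using ln_2_less_1 assms(1) by (simp add: log_def field_simps mult_left_le)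
  finally show ?thesis .
qed

lemma one_add_two_arsinh_le_log:
  fixes f n t \<rho> :: real
  assumes "0 < \<rho>" "2 * \<rho> \<le> f" "1 \<le> n" "1 \<le> t"
  shows "1 + 2 * arsinh (\<rho> / (t * (f / n))) \<le> 3 * log 2 (2 * n)"
proof -
  have "1 * f \<le> t * f"
    using assms by (intro mult_right_mono) auto
  then have "2 * \<rho> \<le> t * f"
    using assms(2) by linarith
  then have "n * (2 * \<rho>) \<le> n * (t * f)"
    using assms(3) by (intro mult_left_mono) auto
  moreover have "0 < t * f"
    using assms by (intro mult_pos_pos) auto
  ultimately have "\<rho> / (t * (f / n)) \<le> n / 2"
    using assms(3) by (simp add: field_simps)
  then have "arsinh (\<rho> / (t * (f / n))) \<le> log 2 (2 * n)"
    using assms(3) by (intro arsinh_half_le_log)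
  moreover have "1 \<le> log 2 (2 * n)"
    using assms(3) by (simp add: log_mult)
  ultimately show ?thesis
    by simp
qed

lemma log_two_mult_nonneg: "0 \<le> log 2 (2 * real n)"
  by (cases "n = 0") (auto simp: log_def)

section \<open>Cheap spheres\<close>

context cone_region
begin

lemma fcov_cone_sphere_le:
  assumes "0 < \<delta>" and z_ge: "\<And>A. A \<in> cones \<Longrightarrow> \<delta> \<le> z A"
    and I: "I \<subseteq> cones" "\<And>A. A \<in> cones \<Longrightarrow> A \<inter> cone_sphere r \<noteq> {} \<Longrightarrow> A \<in> I"
  shows "fcov cones (cone_sphere r)
    \<le> 2 * (\<Sum>A\<in>I. z A / sqrt ((r - cone_dist (apex A))\<^sup>2 + \<delta>\<^sup>2))"
proof -
  define y where
    "y A = (if A \<in> I then 2 * (z A / sqrt ((r - cone_dist (apex A))\<^sup>2 + \<delta>\<^sup>2)) else 0)" for A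
  have "1 \<le> mass cones y {v}" if v: "v \<in> cone_sphere r" for v
  proof (rule one_le_mass_singleton)
    have "v \<in> V"
      using v H_sub by (auto simp: cone_sphere_def)
    then obtain A where "A \<in> cones" "v \<in> A"
      using V_sub_Union_cones by blast
    then have "\<delta> \<le> z A" "z A \<le> weight v"
      using z_ge finite_cones z_nonneg by (auto simp: mass_singleton intro!: member_le_sum)
    then have "\<delta> \<le> weight v"
      by (rule order_trans)
    then show "0 < weight v"
      using \<open>0 < \<delta>\<close> by simp
    fix A assume A: "A \<in> cones" "v \<in> A"
    have "1 / weight v \<le> 2 / sqrt ((r - cone_dist (apex A))\<^sup>2 + \<delta>\<^sup>2)"
      using \<open>0 < \<delta>\<close> \<open>\<delta> \<le> weight v\<close> dist_apex_cone_sphere_le[OF A v]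
      by (rule inverse_le_two_divide_sqrt)
    from mult_left_mono[OF this z_nonneg[OF A(1)]] show "z A / weight v \<le> y A"
      using I(2)[OF A(1)] A(2) v by (auto simp: y_def mult_ac)
  qed
  then have "fractional_cover cones (cone_sphere r) y"
    using z_nonneg by (simp add: fractional_cover_iff_mass y_def)
  then have "fcov cones (cone_sphere r) \<le> sum y cones"
    by (rule fcov_le)
  also have "\<dots> = sum y I"
    using I(1) finite_cones by (intro sum.mono_neutral_right) (auto simp: y_def)
  finally show ?thesis
    by (simp add: y_def sum_distrib_left)
qed

lemma exists_cheap_sphere_in_ring:
  assumes "0 < \<delta>" "\<And>A. A \<in> cones \<Longrightarrow> \<delta> \<le> z A"
    and light: "\<And>v. v \<in> V - S \<Longrightarrow> weight v < \<theta>" and "0 < \<theta>" "a + 2 * \<theta> < b"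
  obtains r where "a < r" "r < b"
    "fcov cones (cone_sphere r)
      \<le> 4 * arsinh ((b - a) / \<delta>) / (b - a - 2 * \<theta>) * apex_mass z (cone_ball b - cone_ball a)"
proof -
  define ring where "ring = {A \<in> cones. apex A \<in> cone_ball b - cone_ball a}"
  obtain r where r: "a + \<theta> < r" "r < b - \<theta>"
    "(\<Sum>A\<in>ring. z A / sqrt ((r - cone_dist (apex A))\<^sup>2 + \<delta>\<^sup>2))
      \<le> 2 * arsinh ((b - a) / \<delta>) / ((b - \<theta>) - (a + \<theta>)) * sum z ring"
    by (rule exists_cheap_radius[of ring z "\<lambda>A. cone_dist (apex A)" a b \<delta> "a + \<theta>" "b - \<theta>"])
      (use assms z_nonneg in \<open>auto simp: ring_def cone_ball_def\<close>)
  have meets: "A \<in> ring" if A: "A \<in> cones" "A \<inter> cone_sphere r \<noteq> {}" for A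
  proof -
    obtain v where v: "v \<in> A" "v \<in> cone_sphere r"
      using A(2) by blast
    then have "v \<in> H" "weight v < \<theta>"
      using light H_sub by (auto simp: cone_sphere_def)
    then show ?thesis
      using dist_apex_cone_sphere_le[OF A(1) v] apex_in_H[OF A(1) v(1)] A(1) r(1,2)
      by (auto simp: ring_def cone_ball_def)
  qed
  have "fcov cones (cone_sphere r)
      \<le> 2 * (\<Sum>A\<in>ring. z A / sqrt ((r - cone_dist (apex A))\<^sup>2 + \<delta>\<^sup>2))"
    using assms(1,2) meets by (intro fcov_cone_sphere_le) (auto simp: ring_def)
  also have "\<dots> \<le> 2 * (2 * arsinh ((b - a) / \<delta>) / ((b - \<theta>) - (a + \<theta>)) * sum z ring)"
    using r(3) by simp
  also have "sum z ring = apex_mass z (cone_ball b - cone_ball a)"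
    by (simp add: apex_mass_def ring_def)
  finally show thesis
    using r(1,2) \<open>0 < \<theta>\<close> by (intro that[of r]) (auto simp: algebra_simps)
qed

lemma cone_ball_mono: "s \<le> t \<Longrightarrow> cone_ball s \<subseteq> cone_ball t"
  by (auto simp: cone_ball_def)

lemma exists_light_ring:
  assumes "0 < \<rho>" and light: "\<And>v. v \<in> V - S \<Longrightarrow> weight v < \<rho> / 2"
    and total: "sum z cones \<le> 2 ^ T * (\<rho> / 2)"
    and far: "w \<in> H" "\<rho> < cone_dist w"
  obtains a where "\<rho> \<le> a" "a + \<rho> / real T \<le> 2 * \<rho>" "T \<noteq> 0"
    "apex_mass z (cone_ball (a + \<rho> / real T) - cone_ball a) \<le> apex_mass z (cone_ball a)"
proof -
  define W where "W = \<rho> / real T"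
  define a where "a j = \<rho> + real j * W" for j
  have "\<rho> / 2 < apex_mass z (cone_ball (a 0))"
    using apex_mass_cone_ball_gt[OF light _ far] \<open>0 < \<rho>\<close> by (simp add: a_def)
  moreover have "apex_mass z (cone_ball (a T)) \<le> 2 ^ T * (\<rho> / 2)"
    using apex_mass_le_total[of z, OF z_nonneg] total by (rule order_trans)
  ultimately obtain j where j: "j < T"
    "apex_mass z (cone_ball (a (Suc j))) \<le> 2 * apex_mass z (cone_ball (a j))"
    using exists_non_doubling[of "\<rho> / 2" "\<lambda>j. apex_mass z (cone_ball (a j))" T] by blast
  have W: "0 < W" "real T * W = \<rho>"
    using j(1) \<open>0 < \<rho>\<close> by (auto simp: W_def)
  have a_Suc: "a (Suc j) = a j + W"
    by (simp add: a_def algebra_simps)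
  have "real (Suc j) * W \<le> real T * W"
    using j(1) W(1) by (intro mult_right_mono) auto
  then have "a j + W \<le> 2 * \<rho>"
    using W(2) unfolding a_Suc[symmetric] by (simp add: a_def)
  have "cone_ball (a j) \<union> (cone_ball (a j + W) - cone_ball (a j)) = cone_ball (a j + W)"
    using cone_ball_mono[of "a j" "a j + W"] W(1) by auto
  then have "apex_mass z (cone_ball (a j + W))
      = apex_mass z (cone_ball (a j)) + apex_mass z (cone_ball (a j + W) - cone_ball (a j))"
    by (subst apex_mass_disjoint_Un[symmetric]) auto
  then have "apex_mass z (cone_ball (a j + W) - cone_ball (a j)) \<le> apex_mass z (cone_ball (a j))"
    using j(2) by (simp add: a_Suc)
  moreover have "\<rho> \<le> a j"
    using W(1) by (simp add: a_def)
  ultimately show thesis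
    using \<open>a j + W \<le> 2 * \<rho>\<close> j(1) by (intro that[of "a j"]) (auto simp: W_def)
qed

lemma exists_cheap_sphere:
  assumes "0 < \<delta>" "\<And>A. A \<in> cones \<Longrightarrow> \<delta> \<le> z A" "0 < \<rho>"
    and light: "\<And>v. v \<in> V - S \<Longrightarrow> weight v < \<rho> / (4 * real T)"
    and total: "sum z cones \<le> 2 ^ T * (\<rho> / 2)"
    and far: "w \<in> H" "\<rho> < cone_dist w"
  obtains r where "\<rho> < r" "r < 2 * \<rho>"
    "fcov cones (cone_sphere r)
      \<le> 8 * real T / \<rho> * arsinh (\<rho> / (real T * \<delta>)) * apex_mass z (cone_ball r)"
proof -
  define W where "W = \<rho> / real T"
  have "\<rho> / (4 * real T) \<le> \<rho> / 2"
    using \<open>0 < \<rho>\<close> divide_left_mono[of 2 "4 * real T" \<rho>] by (cases "T = 0") auto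
  with light have "weight v < \<rho> / 2" if "v \<in> V - S" for v
    using that by fastforce
  from exists_light_ring[OF \<open>0 < \<rho>\<close> this total far]
  obtain a where a: "\<rho> \<le> a" "a + W \<le> 2 * \<rho>" "T \<noteq> 0"
    "apex_mass z (cone_ball (a + W) - cone_ball a) \<le> apex_mass z (cone_ball a)"
    by (auto simp: W_def)
  have W: "0 < W" "\<rho> / (4 * real T) = W / 4"
    using a(3) \<open>0 < \<rho>\<close> by (auto simp: W_def)
  obtain r where r: "a < r" "r < a + W"
    "fcov cones (cone_sphere r)
      \<le> 4 * arsinh (W / \<delta>) / (W / 2) * apex_mass z (cone_ball (a + W) - cone_ball a)"
    using exists_cheap_sphere_in_ring[OF assms(1,2), of "W / 4" a "a + W"] light W by auto
  note a(4)
  also have "apex_mass z (cone_ball a) \<le> apex_mass z (cone_ball r)"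
    using z_nonneg cone_ball_mono r(1) by (intro apex_mass_mono) auto
  finally have "4 * arsinh (W / \<delta>) / (W / 2) * apex_mass z (cone_ball (a + W) - cone_ball a)
      \<le> 4 * arsinh (W / \<delta>) / (W / 2) * apex_mass z (cone_ball r)"
    using W(1) \<open>0 < \<delta>\<close> by (intro mult_left_mono) (auto simp: less_imp_le)
  with r(3) have "fcov cones (cone_sphere r)
      \<le> 8 * real T / \<rho> * arsinh (\<rho> / (real T * \<delta>)) * apex_mass z (cone_ball r)"
    by (simp add: W_def mult_ac)
  with r(1,2) a(1,2) show thesis
    by (intro that[of r]) auto
qed

end

section \<open>Iterated cutting\<close>

context cone_family
begin

definition closed_separator :: "'a set \<Rightarrow> real \<Rightarrow> 'a set \<Rightarrow> bool" where
  "closed_separator X \<phi> S \<longleftrightarrow> S \<subseteq> V \<and> R `` S \<subseteq> S \<and> (\<forall>B\<subseteq>V - S. \<not> heavy E X \<phi> B)"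

definition cheap_cut ::
  "('a set \<Rightarrow> real) \<Rightarrow> real \<Rightarrow> 'a set \<Rightarrow> 'a set \<Rightarrow> 'a set \<Rightarrow> 'a set \<Rightarrow> bool" where
  "cheap_cut z K S H C Z \<longleftrightarrow>
    C \<subseteq> H \<and> Z \<subseteq> H \<and> Z \<noteq> {} \<and> R `` C \<subseteq> S \<union> C \<and> E `` Z \<inter> (H - C) \<subseteq> Z \<and>
    fcov cones C \<le> K * apex_mass z Z"

end

locale cut_iteration = cone_family +
  fixes X S\<^sub>0 :: "'a set" and \<phi> K :: real and z :: "'a set \<Rightarrow> real"
  assumes finite_X: "finite X" and half_le_\<phi>: "1 / 2 \<le> \<phi>" and K_nonneg: "0 \<le> K"
    and z_nonneg: "A \<in> cones \<Longrightarrow> 0 \<le> z A"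
    and S\<^sub>0_sub: "S\<^sub>0 \<subseteq> V" and S\<^sub>0_closed: "R `` S\<^sub>0 \<subseteq> S\<^sub>0"
    and cheap_cut_exists:
      "\<lbrakk>S\<^sub>0 \<subseteq> S; S \<subseteq> V; R `` S \<subseteq> S; component_of E (V - S) H; heavy E X \<phi> H\<rbrakk>
        \<Longrightarrow> \<exists>C Z. cheap_cut z K S H C Z \<and> real (card (Z \<inter> X)) \<le> \<phi> * real (card X)"
begin

text \<open>
  The set \<open>M\<close> confines the heavy sets that are left. Each cut removes from \<open>M\<close> the part that pays
  for it, so no apex is charged twice.
\<close>

definition partial_separator :: "'a set \<Rightarrow> 'a set \<Rightarrow> bool" where
  "partial_separator S M \<longleftrightarrow>
    S\<^sub>0 \<subseteq> S \<and> S \<subseteq> V \<and> R `` S \<subseteq> S \<and> M \<subseteq> V \<and>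
    (\<forall>B\<subseteq>V - S. heavy E X \<phi> B \<longrightarrow> B \<subseteq> M) \<and>
    fcov cones S \<le> fcov cones S\<^sub>0 + K * apex_mass z (V - M)"

lemma partial_separator_initial: "partial_separator S\<^sub>0 V"
  using S\<^sub>0_sub S\<^sub>0_closed K_nonneg apex_mass_nonneg[OF z_nonneg]
  by (auto simp: partial_separator_def)

lemma heavy_disjoint_cut_off:
  assumes H: "component_of E (V - S) H" "heavy E X \<phi> H"
    and cut: "cheap_cut z K S H C Z" "real (card (Z \<inter> X)) \<le> \<phi> * real (card X)"
    and D: "D \<subseteq> V - (S \<union> C)" "heavy E X \<phi> D"
  shows "D \<inter> Z = {}"
proof (rule ccontr)
  assume "D \<inter> Z \<noteq> {}"
  then obtain b where b: "b \<in> D" "b \<in> Z"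
    by blast
  have "connected_in E D"
    using D(2) by (simp add: heavy_def)
  moreover have "D \<inter> H \<noteq> {}"
    using heavy_Int_nonempty[OF finite_X half_le_\<phi> D(2) H(2)] .
  ultimately have "D \<subseteq> H"
    using D(1) H(1) by (intro connected_in_subset_component[of E D "V - S" H]) auto
  then have "E `` (D \<inter> Z) \<inter> D \<subseteq> Z"
    using D(1) cut(1) by (auto simp: cheap_cut_def)
  then have "D \<subseteq> Z"
    using connected_in_subset_closed[OF \<open>connected_in E D\<close> b] by blast
  then have "D \<inter> X \<subseteq> Z"
    by blast
  then show False
    using not_heavy_if_Int_subset[OF finite_X cut(2)] D(2) by blast
qed

lemma partial_separator_cut:
  assumes "partial_separator S M" and H: "component_of E (V - S) H" "heavy E X \<phi> H"
    and cut: "cheap_cut z K S H C Z" "real (card (Z \<inter> X)) \<le> \<phi> * real (card X)"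
  shows "partial_separator (S \<union> C) (M - Z)" "M - Z \<subset> M"
proof -
  have S: "S\<^sub>0 \<subseteq> S" "S \<subseteq> V" "R `` S \<subseteq> S" "M \<subseteq> V" "\<And>B. B \<subseteq> V - S \<Longrightarrow> heavy E X \<phi> B \<Longrightarrow> B \<subseteq> M"
    "fcov cones S \<le> fcov cones S\<^sub>0 + K * apex_mass z (V - M)"
    using assms(1) by (auto simp: partial_separator_def)
  have CZ: "C \<subseteq> H" "Z \<subseteq> H" "Z \<noteq> {}" "R `` C \<subseteq> S \<union> C" "fcov cones C \<le> K * apex_mass z Z"
    using cut(1) by (auto simp: cheap_cut_def)
  have "H \<subseteq> V - S"
    using H(1) by (simp add: component_of_def)
  then have "H \<subseteq> M"
    using S(5) H(2) by blast
  with CZ(2,3) show "M - Z \<subset> M"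
    by blast
  have "D \<subseteq> M - Z" if "D \<subseteq> V - (S \<union> C)" "heavy E X \<phi> D" for D
    using S(5)[of D] heavy_disjoint_cut_off[OF H cut that] that by blast
  moreover have "fcov cones (S \<union> C) \<le> fcov cones S\<^sub>0 + K * apex_mass z (V - (M - Z))"
  proof -
    have "fcov cones (S \<union> C) \<le> fcov cones S + fcov cones C"
      using S(2) CZ(1) \<open>H \<subseteq> V - S\<close> V_sub_Union_cones by (intro fcov_Un_le finite_cones) auto
    also have "\<dots> \<le> fcov cones S\<^sub>0 + K * (apex_mass z (V - M) + apex_mass z Z)"
      using S(6) CZ(5) by (simp add: distrib_left)
    also have "apex_mass z (V - M) + apex_mass z Z = apex_mass z ((V - M) \<union> Z)"
      using CZ(2) \<open>H \<subseteq> M\<close> by (intro apex_mass_disjoint_Un[symmetric]) blast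
    also have "(V - M) \<union> Z = V - (M - Z)"
      using CZ(2) \<open>H \<subseteq> M\<close> S(4) by blast
    finally show ?thesis .
  qed
  moreover have "S\<^sub>0 \<subseteq> S \<union> C" "S \<union> C \<subseteq> V" "R `` (S \<union> C) \<subseteq> S \<union> C" "M - Z \<subseteq> V"
    using S(1-4) CZ(1,4) \<open>H \<subseteq> V - S\<close> by blast+
  ultimately show "partial_separator (S \<union> C) (M - Z)"
    by (simp add: partial_separator_def)
qed

lemma exists_separator:
  obtains S where "closed_separator X \<phi> S"
    "fcov cones S \<le> fcov cones S\<^sub>0 + K * sum z cones"
proof -
  obtain M where "\<exists>S. partial_separator S M"
    and least: "\<And>S' M'. partial_separator S' M' \<Longrightarrow> card M \<le> card M'"
    using ex_has_least_nat[of "\<lambda>M. \<exists>S. partial_separator S M" V card]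
      partial_separator_initial by blast
  then obtain S where SM: "partial_separator S M"
    by blast
  then have S: "S\<^sub>0 \<subseteq> S" "S \<subseteq> V" "R `` S \<subseteq> S" "M \<subseteq> V"
    "fcov cones S \<le> fcov cones S\<^sub>0 + K * apex_mass z (V - M)"
    by (auto simp: partial_separator_def)
  have "\<not> heavy E X \<phi> B" if "B \<subseteq> V - S" for B
  proof
    assume B: "heavy E X \<phi> B"
    then have "B \<noteq> {}"
      using heavy_Int_nonempty[OF finite_X half_le_\<phi> B B] by simp
    then obtain H where H: "component_of E (V - S) H" "B \<subseteq> H"
      using connected_in_extends_to_component[OF sym_E _ \<open>B \<subseteq> V - S\<close>] B by (auto simp: heavy_def)
    then have "heavy E X \<phi> H"
      using heavy_superset[OF finite_X B] by (simp add: component_of_def)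
    then obtain C Z where CZ: "cheap_cut z K S H C Z" "real (card (Z \<inter> X)) \<le> \<phi> * real (card X)"
      using cheap_cut_exists[OF S(1-3) H(1)] by blast
    note cut = partial_separator_cut[OF SM H(1) \<open>heavy E X \<phi> H\<close> CZ]
    have "card (M - Z) < card M"
      using finite_subset[OF S(4) finite_V] cut(2) by (rule psubset_card_mono)
    with least[OF cut(1)] show False
      by simp
  qed
  moreover have "K * apex_mass z (V - M) \<le> K * sum z cones"
    using K_nonneg by (intro mult_left_mono apex_mass_le_total z_nonneg)
  ultimately show thesis
    using S(2,3,5) by (intro that[of S]) (auto simp: closed_separator_def)
qed

end

section \<open>Separators from small mass balls\<close>

context cone_family
begin

definition small_balls :: "'a set \<Rightarrow> real \<Rightarrow> real \<Rightarrow> ('a set \<Rightarrow> real) \<Rightarrow> bool" where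
  "small_balls X \<phi> r z \<longleftrightarrow>
    (\<forall>u\<in>X. real (card (mass_ball V E cones z r u \<inter> X)) \<le> \<phi> * real (card X))"

lemma small_balls_mono_weight:
  assumes "finite X" "small_balls X \<phi> r x" "\<And>A. A \<in> cones \<Longrightarrow> x A \<le> z A"
  shows "small_balls X \<phi> r z"
  unfolding small_balls_def
proof
  fix u assume "u \<in> X"
  have "mass cones x B \<le> r" if "mass cones z B \<le> r" for B
    using mass_mono_weight[of cones x z B, OF assms(3)] that by simp
  then have "mass_ball V E cones z r u \<subseteq> mass_ball V E cones x r u"
    unfolding mass_ball_def by blast
  then have "card (mass_ball V E cones z r u \<inter> X) \<le> card (mass_ball V E cones x r u \<inter> X)"
    using assms(1) by (intro card_mono) auto
  then show "real (card (mass_ball V E cones z r u \<inter> X)) \<le> \<phi> * real (card X)"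
    using assms(2) \<open>u \<in> X\<close> unfolding small_balls_def by fastforce
qed

lemma sum_cones_add_uniform_le:
  assumes "0 \<le> m"
  shows "(\<Sum>A\<in>cones. x A + m / real (card V)) \<le> sum x cones + m"
proof -
  have "real (card cones) * (m / real (card V)) \<le> real (card V) * (m / real (card V))"
    using card_cones_le assms by (intro mult_right_mono) auto
  also have "\<dots> \<le> m"
    using assms by simp
  finally show ?thesis
    by (simp add: sum.distrib)
qed

lemma superlevel_closed:
  assumes "\<And>A. A \<in> cones \<Longrightarrow> 0 \<le> z A"
  shows "R `` {v \<in> V. \<theta> \<le> mass cones z {v}} \<subseteq> {v \<in> V. \<theta> \<le> mass cones z {v}}"
proof
  fix w assume "w \<in> R `` {v \<in> V. \<theta> \<le> mass cones z {v}}"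
  then obtain v where v: "\<theta> \<le> mass cones z {v}" "(v, w) \<in> R"
    by blast
  have "mass cones z {v} \<le> mass cones z {w}"
    using finite_cones assms cone_step[OF _ _ v(2)] by (rule mass_singleton_mono)
  moreover have "w \<in> V"
    using v(2) R_sub E_sub by blast
  ultimately show "w \<in> {v \<in> V. \<theta> \<le> mass cones z {v}}"
    using v(1) by simp
qed

lemma exists_cheap_cut:
  assumes X: "finite X" "1 / 2 \<le> \<phi>" "small_balls X \<phi> (2 * \<rho>) z"
    and z: "0 < \<delta>" "\<And>A. A \<in> cones \<Longrightarrow> \<delta> \<le> z A" "sum z cones \<le> 2 ^ T * (\<rho> / 2)"
    and S: "R `` S \<subseteq> S" "\<And>v. v \<in> V - S \<Longrightarrow> mass cones z {v} < \<rho> / (4 * real T)"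
    and H: "component_of E (V - S) H" "heavy E X \<phi> H" and "0 < \<rho>" "0 < T"
  obtains C Z where "real (card (Z \<inter> X)) \<le> \<phi> * real (card X)"
    "cheap_cut z (8 * real T / \<rho> * arsinh (\<rho> / (real T * \<delta>))) S H C Z"
proof -
  have z_nonneg: "0 \<le> z A" if "A \<in> cones" for A
    using z(1) z(2)[OF that] by simp
  have "H \<inter> X \<noteq> {}"
    using heavy_meets[OF _ H(2)] X(2) by simp
  then obtain u where u: "u \<in> H" "u \<in> X"
    by blast
  interpret cone_region V E R centers z S H u
    using z_nonneg S(1) H(1) u(1) by unfold_locales
  have ball_small: "real (card (cone_ball r \<inter> X)) \<le> \<phi> * real (card X)" if "r \<le> 2 * \<rho>" for r
    using card_cone_ball_le[OF that X(1)] X(3) u(2) unfolding small_balls_def by fastforce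
  have "\<not> H \<subseteq> cone_ball \<rho>"
    using not_heavy_if_Int_subset[OF X(1) ball_small, of \<rho> H] H(2) \<open>0 < \<rho>\<close> by auto
  then obtain w where "w \<in> H" "w \<notin> cone_ball \<rho>"
    by blast
  then have "\<rho> < cone_dist w"
    by (simp add: cone_ball_def)
  with \<open>w \<in> H\<close> obtain r where r: "\<rho> < r" "r < 2 * \<rho>"
    "fcov cones (cone_sphere r)
      \<le> 8 * real T / \<rho> * arsinh (\<rho> / (real T * \<delta>)) * apex_mass z (cone_ball r)"
    using exists_cheap_sphere[OF z(1,2) \<open>0 < \<rho>\<close> S(2) z(3)] by blast
  have "\<rho> / (4 * real T) \<le> \<rho>"
    using \<open>0 < \<rho>\<close> \<open>0 < T\<close> divide_left_mono[of 1 "4 * real T" \<rho>] by simp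
  then have "cone_dist u \<le> r"
    using cone_dist_source_le S(2)[of u] u_in_H H_sub r(1) by auto
  then have "cheap_cut z (8 * real T / \<rho> * arsinh (\<rho> / (real T * \<delta>))) S H
      (cone_sphere r) (cone_ball r)"
    using r(3) u_in_H cone_sphere_closed cone_ball_exit
    unfolding cheap_cut_def by (auto simp: cone_sphere_def cone_ball_def)
  with ball_small[of r] r(2) that show thesis
    by simp
qed

lemma not_heavy_if_total_le:
  assumes "finite X" "0 \<le> \<phi>" "\<And>A. A \<in> cones \<Longrightarrow> 0 \<le> x A" "sum x cones \<le> r" "B \<subseteq> V"
    and small: "small_balls X \<phi> r x"
  shows "\<not> heavy E X \<phi> B"
proof
  assume heavy: "heavy E X \<phi> B"
  with \<open>0 \<le> \<phi>\<close> have "B \<inter> X \<noteq> {}"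
    by (rule heavy_meets)
  then obtain u where u: "u \<in> B" "u \<in> X"
    by blast
  have "mass cones x B \<le> r"
    using mass_le_total[OF finite_cones assms(3)] assms(4) by (rule order_trans)
  then have "B \<subseteq> mass_ball V E cones x r u"
    using assms(5) u(1) heavy by (auto simp: mass_ball_def heavy_def)
  then show False
    using not_heavy_if_Int_subset[OF assms(1), of "mass_ball V E cones x r u"] small u(2) heavy
    unfolding small_balls_def by blast
qed

lemma exists_closed_separator_if_mass_ge:
  assumes X: "finite X" "1 / 2 \<le> \<phi>" "small_balls X \<phi> (2 * \<rho>) z" and "0 < \<rho>" "0 < T"
    and z: "0 < \<delta>" "\<And>A. A \<in> cones \<Longrightarrow> \<delta> \<le> z A" "sum z cones \<le> 2 ^ T * (\<rho> / 2)"
  obtains S where "closed_separator X \<phi> S"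
    "fcov cones S \<le> 4 * real T / \<rho> * (1 + 2 * arsinh (\<rho> / (real T * \<delta>))) * sum z cones"
proof -
  define K where "K = 8 * real T / \<rho> * arsinh (\<rho> / (real T * \<delta>))"
  define S\<^sub>0 where "S\<^sub>0 = {v \<in> V. \<rho> / (4 * real T) \<le> mass cones z {v}}"
  have z_nonneg: "0 \<le> z A" if "A \<in> cones" for A
    using z(1) z(2)[OF that] by simp
  interpret cut_iteration V E R centers X S\<^sub>0 \<phi> K z
  proof
    show "0 \<le> K"
      using \<open>0 < \<rho>\<close> \<open>0 < T\<close> \<open>0 < \<delta>\<close> by (simp add: K_def less_imp_le)
    show "R `` S\<^sub>0 \<subseteq> S\<^sub>0"
      unfolding S\<^sub>0_def using z_nonneg by (rule superlevel_closed)
    fix S H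
    assume S: "S\<^sub>0 \<subseteq> S" "R `` S \<subseteq> S" and H: "component_of E (V - S) H" "heavy E X \<phi> H"
    have light: "mass cones z {v} < \<rho> / (4 * real T)" if "v \<in> V - S" for v
      using that S(1) by (auto simp: S\<^sub>0_def)
    obtain C Z where "real (card (Z \<inter> X)) \<le> \<phi> * real (card X)" "cheap_cut z K S H C Z"
      unfolding K_def by (rule exists_cheap_cut[OF X z S(2) light H \<open>0 < \<rho>\<close> \<open>0 < T\<close>])
    then show "\<exists>C Z. cheap_cut z K S H C Z \<and> real (card (Z \<inter> X)) \<le> \<phi> * real (card X)"
      by blast
  qed (use X z_nonneg in \<open>auto simp: S\<^sub>0_def\<close>)
  obtain S where S: "closed_separator X \<phi> S" "fcov cones S \<le> fcov cones S\<^sub>0 + K * sum z cones"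
    by (rule exists_separator)
  have "fcov cones S\<^sub>0 \<le> sum z cones / (\<rho> / (4 * real T))"
    using \<open>0 < \<rho>\<close> \<open>0 < T\<close> z_nonneg by (intro fcov_superlevel_le) (auto simp: S\<^sub>0_def)
  with S(2) have "fcov cones S
      \<le> 4 * real T / \<rho> * (1 + 2 * arsinh (\<rho> / (real T * \<delta>))) * sum z cones"
    by (simp add: K_def algebra_simps add_divide_distrib)
  with S(1) show thesis
    by (rule that)
qed

text \<open>
  The uniform extra mass \<open>f / card V\<close> per cone at most doubles the total and bounds the ratio of
  scales that enters through \<open>arsinh\<close>.
\<close>

lemma exists_closed_separator_if_total_gt:
  fixes x :: "'a set \<Rightarrow> real"
  defines "f \<equiv> sum x cones" and "n \<equiv> real (card V)"
  assumes X: "finite X" "1 / 2 \<le> \<phi>" "small_balls X \<phi> (2 * \<rho>) x" and "0 < \<rho>" "2 * \<rho> < f"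
    and x: "\<And>A. A \<in> cones \<Longrightarrow> 0 \<le> x A" and T: "4 * f \<le> 2 ^ T * \<rho>"
  obtains S where "closed_separator X \<phi> S"
    "fcov cones S \<le> 24 * real T / \<rho> * log 2 (2 * n) * f"
proof -
  define z where "z A = x A + f / n" for A
  define \<kappa> where "\<kappa> = 1 + 2 * arsinh (\<rho> / (real T * (f / n)))"
  have "0 < f"
    using \<open>0 < \<rho>\<close> \<open>2 * \<rho> < f\<close> by simp
  have "0 < T"
    using T \<open>0 < \<rho>\<close> \<open>2 * \<rho> < f\<close> by (cases T) auto
  have "cones \<noteq> {}"
    using \<open>0 < f\<close> by (auto simp: f_def)
  then have n: "1 \<le> n"
    using apex_in_V finite_V by (auto simp: n_def Suc_le_eq card_gt_0_iff)
  have z_total: "sum z cones \<le> 2 * f"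
    using sum_cones_add_uniform_le[of f x] \<open>0 < f\<close> by (simp add: z_def n_def f_def)
  have z_ge: "x A \<le> z A" "f / n \<le> z A" if "A \<in> cones" for A
    using x[OF that] \<open>0 < f\<close> n by (auto simp: z_def)
  have "0 < f / n" "sum z cones \<le> 2 ^ T * (\<rho> / 2)"
    using \<open>0 < f\<close> n z_total T by auto
  from exists_closed_separator_if_mass_ge[OF X(1,2) small_balls_mono_weight[OF X(1,3) z_ge(1)]
      \<open>0 < \<rho>\<close> \<open>0 < T\<close> this(1) z_ge(2) this(2)]
  obtain S where S: "closed_separator X \<phi> S" "fcov cones S \<le> 4 * real T / \<rho> * \<kappa> * sum z cones"
    unfolding \<kappa>_def by blast
  have "\<kappa> \<le> 3 * log 2 (2 * n)"
    unfolding \<kappa>_def using \<open>0 < \<rho>\<close> \<open>2 * \<rho> < f\<close> \<open>0 < T\<close> n by (intro one_add_two_arsinh_le_log) auto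
  then have "4 * real T / \<rho> * \<kappa> \<le> 4 * real T / \<rho> * (3 * log 2 (2 * n))"
    using \<open>0 < \<rho>\<close> by (intro mult_left_mono) auto
  then have "4 * real T / \<rho> * \<kappa> * sum z cones \<le> 4 * real T / \<rho> * (3 * log 2 (2 * n)) * (2 * f)"
    using z_total
  proof (rule mult_mono)
    show "0 \<le> sum z cones"
      using x z_ge(1) by (intro sum_nonneg) (blast intro: order_trans)
  qed (use \<open>0 < \<rho>\<close> n in simp)
  with S(2) have "fcov cones S \<le> 24 * real T / \<rho> * log 2 (2 * n) * f"
    by (simp add: algebra_simps)
  with S(1) show thesis
    by (rule that)
qed

lemma exists_closed_separator:
  fixes x :: "'a set \<Rightarrow> real"
  defines "f \<equiv> sum x cones"
  assumes X: "finite X" "1 / 2 \<le> \<phi>" "small_balls X \<phi> (2 * \<rho>) x" and "0 < \<rho>"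
    and x: "\<And>A. A \<in> cones \<Longrightarrow> 0 \<le> x A" and T: "4 * f \<le> 2 ^ T * \<rho>"
  obtains S where "closed_separator X \<phi> S"
    "fcov cones S \<le> 24 * real T / \<rho> * log 2 (2 * real (card V)) * f"
proof (cases "f \<le> 2 * \<rho>")
  case True
  have "\<not> heavy E X \<phi> B" if "B \<subseteq> V" for B
    using X(2) True by (intro not_heavy_if_total_le[OF X(1) _ x _ that X(3)]) (auto simp: f_def)
  moreover have "0 \<le> 24 * real T / \<rho> * log 2 (2 * real (card V)) * f"
    using \<open>0 < \<rho>\<close> x log_two_mult_nonneg by (simp add: f_def sum_nonneg)
  ultimately show thesis
    using that[of "{}"] by (simp add: closed_separator_def fcov_empty)
next
  case False
  then have "2 * \<rho> < f"
    by simp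
  from exists_closed_separator_if_total_gt[OF X \<open>0 < \<rho>\<close> this[unfolded f_def] x T[unfolded f_def]]
  show thesis
    using that unfolding f_def by blast
qed

end

section \<open>Induced paths and components\<close>

lemma induced_path_prefix:
  assumes "induced_path G u v (P @ Q)" "P \<noteq> []"
  shows "induced_path G u (last P) P"
proof -
  have "j = Suc i" if "i < j" "j < length P" "(P ! i, P ! j) \<in> parcs G" for i j
    using assms(1) that by (auto simp: induced_path_def nth_append)
  moreover have "vwalk P G"
    using assms(1)
    by (intro vwalkI_append_l[OF assms(2), of Q]) (simp add: induced_path_def vpath_def)
  ultimately show ?thesis
    using assms by (auto simp: induced_path_def vpath_def)
qed

lemma induced_path_snoc:
  assumes P: "induced_path G u v P" and w: "w \<in> pverts G" "w \<notin> set P" "(v, w) \<in> parcs G"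
    and no_shortcut: "\<And>x. x \<in> set (butlast P) \<Longrightarrow> (x, w) \<notin> parcs G"
  shows "induced_path G u w (P @ [w])"
proof -
  have walk: "P \<noteq> []" "last P = v" "vpath P G"
    using P by (auto simp: induced_path_def vpath_def vwalk_def)
  have "vpath (P @ [w]) G"
    using walk w by (auto simp: vpath_def vwalk_def set_vwalk_arcs_snoc)
  moreover have "j = Suc i"
    if ij: "i < j" "j < length (P @ [w])" "((P @ [w]) ! i, (P @ [w]) ! j) \<in> parcs G" for i j
  proof (cases "j = length P")
    case True
    then have "P ! i \<notin> set (butlast P)"
      using ij no_shortcut by (auto simp: nth_append)
    then have "\<not> i < length (butlast P)"
      by (metis nth_butlast nth_mem)
    with True ij(1) show ?thesis
      by simp
  next
    case False
    then show ?thesis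
      using ij P by (auto simp: induced_path_def nth_append)
  qed
  ultimately show ?thesis
    using P walk(1) by (simp add: induced_path_def)
qed

lemma exists_induced_path:
  assumes "(u, v) \<in> rtrancl_on B (parcs G)" "B \<subseteq> pverts G"
  shows "\<exists>P. induced_path G u v P \<and> set P \<subseteq> B"
  using assms(1)
proof (induction rule: rtrancl_on_induct)
  case base
  then have "induced_path G u u [u]"
    using assms(2) by (auto simp: induced_path_def vpath_def vwalk_def)
  then show ?case
    using base by force
next
  case (step v w)
  then obtain P where P: "induced_path G u v P" "set P \<subseteq> B"
    by blast
  show ?case
  proof (cases "w \<in> set P")
    case True
    then obtain ys zs where "P = (ys @ [w]) @ zs"
      by (auto dest: split_list)
    then show ?thesis
      using induced_path_prefix[of G u v "ys @ [w]" zs] P by (intro exI[of _ "ys @ [w]"]) auto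
  next
    case False
    have "v \<in> set P"
      using P(1) by (auto simp: induced_path_def vpath_def vwalk_def)
    then obtain ys x zs where x: "P = (ys @ [x]) @ zs" "(x, w) \<in> parcs G"
      "\<forall>y\<in>set ys. (y, w) \<notin> parcs G"
      using split_list_first_prop[of P "\<lambda>x. (x, w) \<in> parcs G"] step(2) by auto
    then have "induced_path G u x (ys @ [x])"
      using induced_path_prefix[of G u v "ys @ [x]" zs] P(1) by simp
    then have "induced_path G u w ((ys @ [x]) @ [w])"
      using x False step(4) assms(2) by (intro induced_path_snoc) auto
    then show ?thesis
      using x(1) P(2) step(4) by (intro exI[of _ "(ys @ [x]) @ [w]"]) auto
  qed
qed

lemma is_component_connected_in:
  assumes "pair_graph G" and "is_component (with_proj G \<restriction> U) C"
  shows "connected_in (parcs G) (verts C)" "verts C \<subseteq> U"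
proof -
  interpret pair_graph G by fact
  have sub: "subgraph C (with_proj G \<restriction> U)" and conn: "connected C"
    using assms(2) by (auto simp: is_component_def pre_digraph.max_subgraph_def)
  from sub show "verts C \<subseteq> U"
    by (auto simp: subgraph_def)
  have C: "tail C = fst" "head C = snd" "arcs C \<subseteq> parcs G"
    using sub by (auto simp: subgraph_def compatible_def)
  then have "(fst e, snd e) \<in> parcs G" "(snd e, fst e) \<in> parcs G" if "e \<in> arcs C" for e
    using that arcs_symmetric[of "fst e" "snd e"] by auto
  then have arcs: "parcs (mk_symmetric C) \<subseteq> parcs G"
    by (auto simp: parcs_mk_symmetric C)
  show "connected_in (parcs G) (verts C)"
    unfolding connected_in_def
  proof (intro subrelI, elim SigmaE2)
    fix a b assume "a \<in> verts C" "b \<in> verts C"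
    then have "(a, b) \<in> rtrancl_on (verts C) (parcs (mk_symmetric C))"
      using conn by (auto simp: connected_def strongly_connected_def reachable_def)
    then show "(a, b) \<in> rtrancl_on (verts C) (parcs G)"
      by (rule rtrancl_on_mono[OF arcs subset_refl])
  qed
qed

lemma balanced_separator_if_no_heavy:
  assumes "pair_graph G" "S \<subseteq> pverts G" "\<And>B. B \<subseteq> pverts G - S \<Longrightarrow> \<not> heavy (parcs G) X \<phi> B"
  shows "balanced_separator G X \<phi> S"
  unfolding balanced_separator_def
proof (intro conjI allI impI)
  fix C assume "is_component (with_proj G \<restriction> (pverts G - S)) C"
  note C = is_component_connected_in[OF assms(1) this]
  from assms(3)[OF C(2)] C(1) show "real (card (verts C \<inter> X)) \<le> \<phi> * real (card X)"
    by (simp add: heavy_def)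
qed (rule assms(2))

section \<open>Layered families\<close>

lemma descendants_eq_rtrancl:
  assumes "pair_graph G" "u \<in> pverts G"
  shows "descendants G Ls u = (parcs (layer_digraph G Ls))\<^sup>* `` {u}"
proof -
  interpret pair_graph G by fact
  let ?R = "parcs (layer_digraph G Ls)"
  have R: "b \<in> pverts G" if "(a, b) \<in> ?R" for a b
    using that in_arcsD2 by (auto simp: layer_digraph_def)
  have "(u, v) \<in> rtrancl_on (pverts G) ?R" if "(u, v) \<in> ?R\<^sup>*" for v
    using that
  proof induction
    case (step a b)
    then show ?case
      using R rtrancl_on_into_rtrancl_on by metis
  qed (use assms(2) in simp)
  then have "(u, v) \<in> rtrancl_on (pverts G) ?R \<longleftrightarrow> (u, v) \<in> ?R\<^sup>*" for v
    using rtrancl_on_rtranclI by metis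
  then show ?thesis
    by (simp add: descendants_def reachable_def layer_digraph_def Image_singleton)
qed

lemma downward_closed_if_Image_subset:
  assumes "pair_graph G" "S \<subseteq> pverts G" "parcs (layer_digraph G Ls) `` S \<subseteq> S"
  shows "downward_closed G Ls S"
  unfolding downward_closed_def
proof
  fix u assume "u \<in> S"
  then have "descendants G Ls u = (parcs (layer_digraph G Ls))\<^sup>* `` {u}"
    using assms(2) by (intro descendants_eq_rtrancl[OF assms(1)]) auto
  also have "\<dots> \<subseteq> (parcs (layer_digraph G Ls))\<^sup>* `` S"
    using \<open>u \<in> S\<close> by blast
  also have "\<dots> = S"
    using assms(3) by (rule Image_closed_trancl)
  finally show "descendants G Ls u \<subseteq> S" .
qed

lemma layered_family_eq_image_rtrancl:
  assumes "pair_graph G"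
  shows "layered_family G Ls = (\<lambda>c. (parcs (layer_digraph G Ls))\<^sup>* `` {c}) ` layer_centers G Ls"
  unfolding layered_family_def layer_centers_def
  using descendants_eq_rtrancl[OF assms] by (intro image_cong) auto

lemma cone_family_layer_digraph:
  assumes "pair_graph G" "ordered_partition (pverts G) Ls"
  shows "cone_family (pverts G) (parcs G) (parcs (layer_digraph G Ls)) (layer_centers G Ls)"
proof -
  interpret pair_graph G by fact
  let ?R = "parcs (layer_digraph G Ls)"
  have centers: "layer_centers G Ls \<subseteq> pverts G"
    by (auto simp: layer_centers_def)
  show ?thesis
  proof
    show "parcs G \<subseteq> pverts G \<times> pverts G"
      using in_arcsD1 in_arcsD2 by auto
    show "sym (parcs G)"
      using sym_arcs by (simp add: symmetric_def)
    show "?R \<subseteq> parcs G"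
      by (auto simp: layer_digraph_def)
    show "pverts G \<subseteq> ?R\<^sup>* `` layer_centers G Ls"
      using layered_family_covers[OF assms(2)]
      unfolding layered_family_eq_image_rtrancl[OF assms(1)] by auto
  qed (use centers in auto)
qed

section \<open>The linear program\<close>

lemma card_small_values_le:
  fixes d :: "'a \<Rightarrow> real"
  assumes "finite X" "Z \<subseteq> X" and le_1: "\<And>v. v \<in> X \<Longrightarrow> d v \<le> 1" and small: "\<And>v. v \<in> Z \<Longrightarrow> d v \<le> r"
    and "\<beta> * real (card X) \<le> sum d X"
  shows "(1 - r) * real (card Z) \<le> (1 - \<beta>) * real (card X)"
proof -
  have "\<beta> * real (card X) \<le> sum d (X - Z) + sum d Z"
    using assms(5) sum.subset_diff[OF assms(2,1), of d] by simp
  also have "\<dots> \<le> real (card (X - Z)) * 1 + real (card Z) * r"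
    using assms(2) le_1 small by (intro add_mono sum_bounded_above) auto
  also have "real (card (X - Z)) = real (card X) - real (card Z)"
    using assms(1,2) by (simp add: card_Diff_subset card_mono finite_subset of_nat_diff)
  finally show ?thesis
    by (simp add: algebra_simps)
qed

lemma separator_lp_card_mass_ball_le:
  assumes lp: "separator_lp_feasible G \<F> X x d" and "finite \<F>" "finite X" "u \<in> X"
  shows "(1 - r) * real (card (mass_ball (pverts G) (parcs G) \<F> x r u \<inter> X))
    \<le> (1 - 1 / 10) * real (card X)"
proof (rule card_small_values_le)
  fix v assume v: "v \<in> mass_ball (pverts G) (parcs G) \<F> x r u \<inter> X"
  then obtain B where B: "B \<subseteq> pverts G" "connected_in (parcs G) B" "u \<in> B" "v \<in> B" "mass \<F> x B \<le> r"
    by (auto simp: mass_ball_def)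
  then obtain P where P: "induced_path G u v P" "set P \<subseteq> B"
    using exists_induced_path[of u v B G] by (auto simp: connected_in_def)
  then have "d u v \<le> mass \<F> x (set P)"
    using lp \<open>u \<in> X\<close> v by (auto simp: separator_lp_feasible_def mass_def)
  also have "\<dots> \<le> mass \<F> x B"
    using \<open>finite \<F>\<close> lp P(2) by (intro mass_mono) (auto simp: separator_lp_feasible_def)
  finally show "d u v \<le> r"
    using B(5) by simp
qed (use lp \<open>finite X\<close> \<open>u \<in> X\<close> in \<open>auto simp: separator_lp_feasible_def\<close>)

lemma exists_power_two_ge:
  assumes "0 \<le> f"
  obtains T :: nat where "256 * f \<le> 2 ^ T" "real T \<le> 5 * log 2 (f + 4)"
proof
  define T where "T = nat \<lceil>4 * log 2 (f + 4)\<rceil>"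
  have "2 \<le> log 2 (f + 4)"
    using assms by (simp add: le_log_iff)
  then have T: "4 * log 2 (f + 4) \<le> real T" "real T \<le> 4 * log 2 (f + 4) + 1"
    unfolding T_def by linarith+
  then show "real T \<le> 5 * log 2 (f + 4)"
    using \<open>2 \<le> log 2 (f + 4)\<close> by simp
  have "16 * f \<le> (f + 4)\<^sup>2" "16 \<le> (f + 4)\<^sup>2"
    using assms sum_squares_ge_zero[of "f - 4" 0] by (auto simp: power2_eq_square algebra_simps)
  then have "16 * f * 16 \<le> (f + 4)\<^sup>2 * (f + 4)\<^sup>2"
    using assms by (intro mult_mono) auto
  also have "\<dots> = (2 powr log 2 (f + 4)) powr 4"
    using assms by (simp flip: power_add)
  also have "\<dots> = 2 powr (4 * log 2 (f + 4))"
    by (simp add: powr_powr mult.commute)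
  also have "\<dots> \<le> 2 powr real T"
    using T(1) by simp
  also have "\<dots> = 2 ^ T"
    by (simp add: powr_realpow)
  finally show "256 * f \<le> 2 ^ T"
    using assms by simp
qed

lemma separator_if_lp_feasible:
  assumes G: "pair_graph G" and Ls: "ordered_partition (pverts G) Ls"
    and family: "\<F> = layered_family G Ls" and X: "X \<subseteq> layer_centers G Ls"
    and lp: "separator_lp_feasible G \<F> X x d"
  obtains S where "balanced_separator G X (95 / 100) S" "downward_closed G Ls S"
    "fcov \<F> S \<le> 4560 * log 2 (2 * real (card (pverts G))) * log 2 (sum x \<F> + 4) * sum x \<F>"
proof -
  interpret cone_family "pverts G" "parcs G" "parcs (layer_digraph G Ls)" "layer_centers G Ls"
    using G Ls by (rule cone_family_layer_digraph)
  have \<F>: "\<F> = cones"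
    using layered_family_eq_image_rtrancl[OF G] by (simp add: family cones_def)
  let ?f = "sum x \<F>" and ?L = "log 2 (2 * real (card (pverts G)))"
  have "finite X"
    using X centers_sub finite_V by (meson finite_subset)
  have x: "0 \<le> x A" if "A \<in> cones" for A
    using lp that by (simp add: separator_lp_feasible_def \<F>)
  then have "0 \<le> ?f"
    by (simp add: \<F> sum_nonneg)
  then obtain T :: nat where T: "256 * ?f \<le> 2 ^ T" "real T \<le> 5 * log 2 (?f + 4)"
    by (rule exists_power_two_ge)
  have "4 * sum x cones \<le> 2 ^ T * (1 / 38)"
    using T(1) \<open>0 \<le> ?f\<close> by (simp add: \<F>)
  \<comment> \<open>The radius \<open>2 / 38 = 1 / 19\<close> turns the factor \<open>9 / 10\<close> of the program into \<open>95 / 100\<close>.\<close>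
  have "small_balls X (95 / 100) (2 * (1 / 38)) x"
    using separator_lp_card_mass_ball_le[OF lp _ \<open>finite X\<close>, of _ "1 / 19"] finite_cones
    by (simp add: small_balls_def \<F> mult.commute)
  then obtain S where S: "closed_separator X (95 / 100) S"
    "fcov cones S \<le> 24 * real T / (1 / 38) * ?L * sum x cones"
    using exists_closed_separator[OF \<open>finite X\<close>, of "95 / 100" "1 / 38" x T] x
      \<open>4 * sum x cones \<le> 2 ^ T * (1 / 38)\<close> by auto
  have "fcov \<F> S \<le> 912 * real T * (?L * ?f)"
    using S(2) by (simp add: \<F> mult.assoc)
  also have "\<dots> \<le> 4560 * log 2 (?f + 4) * (?L * ?f)"
    using T(2) \<open>0 \<le> ?f\<close> log_two_mult_nonneg by (intro mult_right_mono mult_nonneg_nonneg) auto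
  finally have "fcov \<F> S \<le> 4560 * ?L * log 2 (?f + 4) * ?f"
    by (simp add: mult_ac)
  then show thesis
    using S(1) balanced_separator_if_no_heavy[OF G] downward_closed_if_Image_subset[OF G]
    by (intro that[of S]) (auto simp: closed_separator_def)
qed

theorem theorem6p1:
  fixes G :: "'a pair_pre_digraph" and Ls :: "'a set list" and \<F> :: "'a set set"
    and n k :: nat and X :: "'a set" and f :: real
  assumes "pair_graph G" and "n = card (pverts G)"
    and "k > 0"
    and "ordered_partition (pverts G) Ls"
    and "\<F> = layered_family G Ls"
    and "thickness Ls \<F> \<le> k"
    and "X \<subseteq> layer_centers G Ls"
    and "f = separator_lp_opt G \<F> X"
  shows "\<exists>S. balanced_separator G X (95 / 100) S \<and> downward_closed G Ls S \<and>
           fcov \<F> S \<le> 5000 * real k * log 2 (2 * real n) * log 2 (f + 4) * f"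
proof -
  let ?B = "log 2 (2 * real n) * log 2 (f + 4) * f"
  have "finite \<F>" "pverts G \<subseteq> \<Union>\<F>"
    using finite_layered_family layered_family_covers assms by blast+
  then obtain x d where lp: "separator_lp_feasible G \<F> X x d" and f: "sum x \<F> = f"
    using separator_lp_opt_attained assms(8) by blast
  obtain S where "balanced_separator G X (95 / 100) S" "downward_closed G Ls S"
    and fcov: "fcov \<F> S \<le> 4560 * ?B"
    using separator_if_lp_feasible[OF assms(1,4,5,7) lp] unfolding f assms(2) by (metis mult.assoc)
  have "0 \<le> f"
    using lp unfolding f[symmetric] by (intro sum_nonneg) (simp add: separator_lp_feasible_def)
  then have "0 \<le> ?B"
    using log_two_mult_nonneg by simp
  then have "4560 * ?B \<le> 5000 * real k * ?B"
    using assms(3) by (intro mult_right_mono) auto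
  with fcov have "fcov \<F> S \<le> 5000 * real k * ?B"
    by (rule order_trans)
  then show ?thesis
    using \<open>balanced_separator G X (95 / 100) S\<close> \<open>downward_closed G Ls S\<close> by (auto simp: mult.assoc)
qed

end
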